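(* The restriction of $\widetilde{T}$ to $Y'$ is measure preserving with respect to $\nu$, and $(Y',\mathbb{B}_{Y'},\nu,\widetilde{T})$ is isomorphic, as a measure dynamical system, to the $2$-adic odometer $(\mathbb{Z}_2, x\mapsto x+1)$ (with the normalized Haar measure $\mu_2$ on $\mathbb{Z}_2$). More precisely, there is a map $\phi:\mathbb{Z}_2\to Y'$ which is almost one-to-one and measure preserving such that $$\phi(x+1)=\widetilde{T}(\phi(x))\quad\text{for } \mu_2\text{-almost every } x\in\mathbb{Z}_2 .$$ Moreover, with the map $\rho:\mathbb{Z}_2\to\mathbb{Z}_2$, $\rho(x)=\dfrac{x-(x \bmod 4)}{4}$ (where $x\bmod 4\in\{0,1,2,3\}$), the same $\phi$ satisfies $$\phi(\rho(x))=S(\phi(x))\quad\text{for } \mu_2\text{-almost every } x\in\mathbb{Z}_2 .$$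
   Context: Let $\zeta=\exp(2\pi i/5)$ and $\omega=\frac{1+\sqrt5}{2}$. Let $L=[0,1)+(-\zeta^{-1})[0,1)=\{s-t\zeta^{-1}: s,t\in[0,1)\}\subset\mathbb{C}$, and put $\Delta=\{x\in L:\operatorname{Im}(x/\zeta)\ge 0\}$, $\mathcal{Z}=L\setminus\Delta$. The map $T:L\to L$ is the bijective piecewise isometry $T(x)=x/\zeta$ for $x\in\Delta$ and $T(x)=(x-1)/\zeta$ for $x\in\mathcal{Z}$. $\widetilde{T}$ is the first return map of $T$ to $T(\mathcal{Z})$; explicitly, for $x\in T(\mathcal{Z})$, $\widetilde{T}(x)=T^2(x)$ if $x\in\Delta$ and $\widetilde{T}(x)=T(x)$ if $x\in T(\mathcal{Z})\setminus\Delta$. Let $L'=\omega^{-2}L$. The partial map $U$ on $L$ is the first hitting map to $L'$: $U(x)=T^{m}(x)$ where $m\ge 0$ is the minimal non-negative integer with $T^m(x)\in L'$ ($U(x)$ is undefined if there is no such $m$). Put $S(x)=\omega^2U(x)$. Put $d_0=0$, $d_2=\zeta$, $d_3=\zeta/\omega$, $d_5=-\frac{1}{\omega\zeta}$. $Y'$ is the unique non-empty compact subset of $\mathbb{C}$ satisfying $Y'=\bigcup_{m\in\{0,2,3,5\}}\left(\frac{\zeta^m}{\omega^2}Y'+d_m\right)$. $\nu$ is the self-similar measure on $Y'$, i.e. the unique Borel probability measure on $Y'$ satisfying $$\nu(X)=\frac14\sum_{m\in\{0,2,3,5\}}\nu\left(\frac{\omega^2}{\zeta^m}(X-d_m)\right)$$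 for all measurable $X$, and $\mathbb{B}_{Y'}$ is the $\sigma$-algebra of $\nu$-measurable subsets of $Y'$. The maps $\widetilde{T}$ and $S$ on $Y'$ are considered up to $\nu$-null sets (they are defined $\nu$-almost everywhere on $Y'$). "Almost one-to-one" means one-to-one after removing null sets. *)

theory Defs
  imports "HOL-Probability.Probability"
begin

section \<open>The ring of 2-adic integers\<close>

text \<open>The inverse limit of the rings Z/2^n: \<^term>\<open>residue x n\<close> is the representative
  in {0..<2^n} of the class of \<^term>\<open>x\<close> modulo 2^n.\<close>

typedef padic2 =
  "{x :: nat \<Rightarrow> int. \<forall>n. x n \<in> {0..<2 ^ n} \<and> x (Suc n) mod 2 ^ n = x n}"
  morphisms residue Abs_padic2
  by (rule exI[of _ "\<lambda>_. 0"]) simp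

lemma residue_range: "0 \<le> residue x n" "residue x n < 2 ^ n"
  using residue[of x] by auto

lemma residue_Suc_mod: "residue x (Suc n) mod 2 ^ n = residue x n"
  using residue[of x] by auto

lemma residue_mod: "residue x n mod 2 ^ n = residue x n"
  using residue_range[of x n] by simp

lemma residue_0 [simp]: "residue x 0 = 0"
  using residue_range[of x 0] by simp

lemma padic2_eqI: "(\<And>n. residue x n = residue y n) \<Longrightarrow> x = y"
  by (metis ext residue_inject)

lemma residue_Abs_padic2:
  assumes "\<And>n. f (Suc n) mod 2 ^ n = (f n :: int) mod 2 ^ n"
  shows "residue (Abs_padic2 (\<lambda>n. f n mod 2 ^ n)) n = f n mod 2 ^ n"
proof -
  have "f (Suc n) mod 2 ^ Suc n mod 2 ^ n = f n mod 2 ^ n" for n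
    using assms[of n] by (simp add: mod_mod_cancel)
  then show ?thesis by (subst Abs_padic2_inverse) auto
qed

instantiation padic2 :: comm_ring_1
begin

definition zero_padic2 :: padic2 where "0 = Abs_padic2 (\<lambda>n. 0 mod 2 ^ n)"
definition one_padic2 :: padic2 where "1 = Abs_padic2 (\<lambda>n. 1 mod 2 ^ n)"
definition plus_padic2 :: "padic2 \<Rightarrow> padic2 \<Rightarrow> padic2" where
  "x + y = Abs_padic2 (\<lambda>n. (residue x n + residue y n) mod 2 ^ n)"
definition times_padic2 :: "padic2 \<Rightarrow> padic2 \<Rightarrow> padic2" where
  "x * y = Abs_padic2 (\<lambda>n. (residue x n * residue y n) mod 2 ^ n)"
definition uminus_padic2 :: "padic2 \<Rightarrow> padic2" where
  "- x = Abs_padic2 (\<lambda>n. (- residue x n) mod 2 ^ n)"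
definition minus_padic2 :: "padic2 \<Rightarrow> padic2 \<Rightarrow> padic2" where
  "x - y = Abs_padic2 (\<lambda>n. (residue x n - residue y n) mod 2 ^ n)"

lemma residue_zero: "residue 0 n = 0"
  unfolding zero_padic2_def by (subst residue_Abs_padic2) auto

lemma residue_one: "residue 1 n = 1 mod 2 ^ n"
  unfolding one_padic2_def by (subst residue_Abs_padic2) auto

lemma residue_add: "residue (x + y) n = (residue x n + residue y n) mod 2 ^ n"
  unfolding plus_padic2_def
  by (rule residue_Abs_padic2) (metis mod_add_eq residue_Suc_mod)

lemma residue_mult: "residue (x * y) n = (residue x n * residue y n) mod 2 ^ n"
  unfolding times_padic2_def
  by (rule residue_Abs_padic2) (metis mod_mult_eq residue_Suc_mod)

lemma residue_uminus: "residue (- x) n = (- residue x n) mod 2 ^ n"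
  unfolding uminus_padic2_def
  by (rule residue_Abs_padic2) (metis mod_minus_eq residue_Suc_mod)

lemma residue_diff: "residue (x - y) n = (residue x n - residue y n) mod 2 ^ n"
  unfolding minus_padic2_def
  by (rule residue_Abs_padic2) (metis mod_diff_eq residue_Suc_mod)

lemmas residue_simps =
  residue_zero residue_one residue_add residue_mult residue_uminus residue_diff

instance
proof
  fix a b c :: padic2
  show "a * b * c = a * (b * c)"
    by (rule padic2_eqI) (simp add: residue_simps mod_simps algebra_simps)
  show "a * b = b * a"
    by (rule padic2_eqI) (simp add: residue_simps mod_simps algebra_simps)
  show "1 * a = a"
    by (rule padic2_eqI) (simp add: residue_simps residue_mod mod_simps)
  show "a + b + c = a + (b + c)"
    by (rule padic2_eqI) (simp add: residue_simps mod_simps algebra_simps)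
  show "a + b = b + a"
    by (rule padic2_eqI) (simp add: residue_simps algebra_simps)
  show "0 + a = a"
    by (rule padic2_eqI) (simp add: residue_simps residue_mod)
  show "- a + a = 0"
    by (rule padic2_eqI) (simp add: residue_simps mod_simps)
  show "a - b = a + - b"
    by (rule padic2_eqI) (simp add: residue_simps mod_simps)
  show "(a + b) * c = a * c + b * c"
    by (rule padic2_eqI) (simp add: residue_simps mod_simps algebra_simps)
  show "(0::padic2) \<noteq> 1"
  proof
    assume "(0::padic2) = 1"
    then have "residue 0 1 = residue 1 1" by simp
    then show False by (simp add: residue_simps)
  qed
qed

end

instantiation padic2 :: topological_space
begin

definition open_padic2 :: "padic2 set \<Rightarrow> bool" where
  "open_padic2 V \<longleftrightarrow> (\<forall>x\<in>V. \<exists>n. \<forall>y. residue y n = residue x n \<longrightarrow> y \<in> V)"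

lemma residue_le_mod: "n \<le> m \<Longrightarrow> residue x m mod 2 ^ n = residue x n"
proof (induction m rule: dec_induct)
  case base
  then show ?case by (rule residue_mod)
next
  case (step k)
  have "residue x (Suc k) mod 2 ^ n = residue x (Suc k) mod 2 ^ k mod 2 ^ n"
    using step by (simp add: mod_mod_cancel le_imp_power_dvd)
  then show ?case using step by (simp add: residue_Suc_mod)
qed

instance
proof
  show "open (UNIV :: padic2 set)" by (simp add: open_padic2_def)
next
  fix S T :: "padic2 set"
  assume S: "open S" and T: "open T"
  show "open (S \<inter> T)"
    unfolding open_padic2_def
  proof
    fix x assume x: "x \<in> S \<inter> T"
    obtain m where m: "\<And>y. residue y m = residue x m \<Longrightarrow> y \<in> S"
      using S x unfolding open_padic2_def by blast
    obtain k where k: "\<And>y. residue y k = residue x k \<Longrightarrow> y \<in> T"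
      using T x unfolding open_padic2_def by blast
    have "y \<in> S \<inter> T" if "residue y (max m k) = residue x (max m k)" for y
      using that m[of y] k[of y] residue_le_mod[of m "max m k"] residue_le_mod[of k "max m k"]
      by (metis IntI max.cobounded1 max.cobounded2)
    then show "\<exists>n. \<forall>y. residue y n = residue x n \<longrightarrow> y \<in> S \<inter> T" by blast
  qed
next
  fix K :: "padic2 set set"
  assume "\<forall>S\<in>K. open S"
  then show "open (\<Union> K)" unfolding open_padic2_def by (metis Union_iff)
qed

end

definition padic2_haar :: "padic2 measure" where
  "padic2_haar = (THE M. sets M = sets borel \<and> prob_space M \<and>
     (\<forall>a. \<forall>A\<in>sets borel. emeasure M ((\<lambda>x. a + x) ` A) = emeasure M A))"

definition rho :: "padic2 \<Rightarrow> padic2" where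
  "rho x = (THE y. 4 * y = x - of_int (residue x 2))"


section \<open>The piecewise isometry and its induced maps\<close>

definition zeta :: complex where
  "zeta = exp (2 * of_real pi * \<i> / 5)"

definition omega :: real where
  "omega = (1 + sqrt 5) / 2"

definition L :: "complex set" where
  "L = {of_real s - of_real t * inverse zeta | s t. s \<in> {0..<1} \<and> t \<in> {0..<1}}"

definition Delta :: "complex set" where
  "Delta = {x \<in> L. Im (x / zeta) \<ge> 0}"

definition Z :: "complex set" where
  "Z = L - Delta"

text \<open>Only the values on \<^term>\<open>L\<close> are meaningful.\<close>

definition T :: "complex \<Rightarrow> complex" where
  "T x = (if x \<in> Delta then x / zeta else (x - 1) / zeta)"

definition first_return :: "('a \<Rightarrow> 'a) \<Rightarrow> 'a set \<Rightarrow> 'a \<Rightarrow> 'a option" where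
  "first_return f A x =
     (if x \<in> A \<and> (\<exists>n>0. (f ^^ n) x \<in> A)
      then Some ((f ^^ (LEAST n. n > 0 \<and> (f ^^ n) x \<in> A)) x) else None)"

definition T_tilde :: "complex \<Rightarrow> complex option" where
  "T_tilde = first_return T (T ` Z)"

definition L' :: "complex set" where
  "L' = (\<lambda>x. x / (of_real omega)\<^sup>2) ` L"

definition U :: "complex \<Rightarrow> complex option" where
  "U x = (if x \<in> L \<and> (\<exists>m. (T ^^ m) x \<in> L')
          then Some ((T ^^ (LEAST m. (T ^^ m) x \<in> L')) x) else None)"

definition S :: "complex \<Rightarrow> complex option" where
  "S x = map_option (\<lambda>z. (of_real omega)\<^sup>2 * z) (U x)"


section \<open>The self-similar set and measure\<close>

text \<open>Only the indices 0, 2, 3 and 5 are used.\<close>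

definition d :: "nat \<Rightarrow> complex" where
  "d m = (if m = 2 then zeta
          else if m = 3 then zeta / of_real omega
          else if m = 5 then - 1 / (of_real omega * zeta)
          else 0)"

definition Y' :: "complex set" where
  "Y' = (THE Y. Y \<noteq> {} \<and> compact Y \<and>
     Y = (\<Union>m\<in>{0, 2, 3, 5}. (\<lambda>y. zeta ^ m / (of_real omega)\<^sup>2 * y + d m) ` Y))"

text \<open>The space of \<open>\<nu>\<close> is \<^term>\<open>Y'\<close> itself, so the expanded copies of a set have to be
  cut down to \<^term>\<open>Y'\<close>.\<close>

definition nu :: "complex measure" where
  "nu = (THE M. sets M = sets (restrict_space borel Y') \<and> prob_space M \<and>
     (\<forall>X\<in>sets M. measure M X =
        1 / 4 * (\<Sum>m\<in>{0, 2, 3, 5}.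
          measure M ((\<lambda>x. (of_real omega)\<^sup>2 / zeta ^ m * (x - d m)) ` X \<inter> Y'))))"


section \<open>Measure dynamical systems given by partial maps\<close>

text \<open>On a finite measure space, taking \<open>E = space M\<close> shows that \<open>g\<close> is defined almost
  everywhere on \<open>space M\<close> with values in \<open>space M\<close>.\<close>

definition preserves_measure :: "'a measure \<Rightarrow> ('a \<Rightarrow> 'a option) \<Rightarrow> bool" where
  "preserves_measure M g \<longleftrightarrow>
     (\<forall>E\<in>sets M. {x \<in> space M. \<exists>y\<in>E. g x = Some y} \<in> sets M \<and>
        emeasure M {x \<in> space M. \<exists>y\<in>E. g x = Some y} = emeasure M E)"

definition almost_inj :: "'a measure \<Rightarrow> ('a \<Rightarrow> 'b) \<Rightarrow> bool" where
  "almost_inj M \<phi> \<longleftrightarrow> (\<exists>N\<in>null_sets M. inj_on \<phi> (space M - N))"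

text \<open>\<open>\<phi>\<close> is a bimeasurable, measure-preserving bijection between sets \<open>A\<close> and \<open>B\<close> of full
  measure that intertwines \<open>f\<close> and \<open>g\<close>; \<open>A\<close> is invariant under \<open>f\<close>, and hence \<open>B\<close> under \<open>g\<close>.\<close>

definition mds_isomorphism ::
  "'a measure \<Rightarrow> ('a \<Rightarrow> 'a option) \<Rightarrow> 'b measure \<Rightarrow> ('b \<Rightarrow> 'b option) \<Rightarrow> ('a \<Rightarrow> 'b) \<Rightarrow> bool" where
  "mds_isomorphism M f N g \<phi> \<longleftrightarrow>
     (\<exists>A\<in>sets M. \<exists>B\<in>sets N.
        space M - A \<in> null_sets M \<and> space N - B \<in> null_sets N \<and>
        bij_betw \<phi> A B \<and>
        \<phi> \<in> restrict_space M A \<rightarrow>\<^sub>M restrict_space N B \<and>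
        inv_into A \<phi> \<in> restrict_space N B \<rightarrow>\<^sub>M restrict_space M A \<and>
        (\<forall>E\<in>sets N. E \<subseteq> B \<longrightarrow> emeasure M (\<phi> -` E \<inter> A) = emeasure N E) \<and>
        (\<forall>x\<in>A. \<exists>y\<in>A. f x = Some y \<and> g (\<phi> x) = Some (\<phi> y)))"

end

theory Submission
  imports Defs
begin

text \<open>
  The idea is that the first return map, seen on the self-similar set, is an adding machine. Write
  \<open>branch m y = \<zeta>\<^sup>m y / \<omega>\<^sup>2 + d m\<close>, so that \<open>Y'\<close> is the union of its images under the four branches
  \<open>m = 5, 3, 2, 0\<close>, and number these branches by the base-4 digits \<open>0, 1, 2, 3\<close> in this order. If \<open>y\<close>
  lies in a suitable region, then the first return map sends \<open>branch 5 y\<close> to \<open>branch 3 y\<close>, this to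
  \<open>branch 2 y\<close> and this to \<open>branch 0 y\<close>, whereas \<open>branch 0 y\<close> goes to \<open>branch 5\<close> of the first return of
  \<open>y\<close> (lemma \<open>return_map_branch\<close>). This is the rule "add one and carry". Moreover, \<open>m\<close> is exactly the
  time that \<open>branch m y\<close> needs under \<open>T\<close> to hit \<open>L'\<close>, namely in \<open>y / \<omega>\<^sup>2\<close> (lemma \<open>hitting_time\<close>);
  hence \<open>S\<close> undoes one branch, which is what \<open>rho\<close> does with the lowest digit.

  Accordingly \<open>\<phi>\<close> is the coding map: \<open>coding x\<close> is the limit of the compositions of branches prescribed
  by the base-4 digits of \<open>x\<close>. Haar measure on the 2-adic integers makes the digits independent and
  uniform, so its image under the coding map is self-similar; uniqueness of the self-similar measure
  identifies it with \<open>\<nu>\<close>, and uniqueness of the attractor identifies the closure of the range with \<open>Y'\<close>.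

  The geometry is only clean away from the boundary, and the whole argument about null sets
  rests on one polygon. In the coordinates \<open>x = a - b / \<zeta>\<close>, where \<open>L\<close> is the unit square, the non-convex
  polygon \<open>hull_region\<close> is mapped into itself by every branch, and so contains \<open>Y'\<close>; the set
  \<open>region\<close> obtained by deleting three of its edges is also mapped into itself, and all claims above hold
  for \<open>y\<close> in \<open>region\<close>. Applying branch \<open>3\<close> twice sends the whole polygon into \<open>region\<close>. Therefore
  a point can be coded outside \<open>region\<close> only if its shift is and its digits do not start with \<open>1, 1\<close>;
  the measure \<open>q\<close> of these points satisfies \<open>q \<le> q - q / 16\<close>, so it vanishes (lemma \<open>measure_bad\<close>).

  The integers all of whose shifts are coded into \<open>region\<close> form a set \<open>good\<close> of full measure.
  On it the digits can be read off from the coded point, since they are the hitting times; this gives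
  the Borel inverse \<open>decode\<close>. The carry could run through infinitely many digits only
  if all digits were \<open>3\<close>, but then \<open>x\<close> is coded by the fixed point \<open>0\<close> of branch \<open>0\<close>, which is not in
  \<open>region\<close>. Hence \<open>good\<close> is invariant under adding one, and the coding map is an isomorphism.
\<close>

section \<open>Base-4 digits of 2-adic integers\<close>

definition digit :: "padic2 \<Rightarrow> nat" where
  "digit x = nat (residue x 2)"

lemma digit_less: "digit x < 4"
  using residue_range[of x 2] by (simp add: digit_def)

lemma of_nat_digit: "int (digit x) = residue x 2"
  using residue_range[of x 2] by (simp add: digit_def)

lemma residue_of_nat: "residue (of_nat k) n = int k mod 2 ^ n"
  by (induction k) (simp_all add: residue_simps mod_simps)

lemma residue_numeral: "residue (numeral w) n = numeral w mod 2 ^ n"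
  using residue_of_nat[of "numeral w" n] by simp

lemma residue_eq_mono: "residue x m = residue y m \<Longrightarrow> n \<le> m \<Longrightarrow> residue x n = residue y n"
  by (metis residue_le_mod)

text \<open>The residue of \<open>4 x\<close> at level \<open>n + 2\<close> determines that of \<open>x\<close> at level \<open>n\<close>.\<close>

lemma four_mult_inject: "4 * x = 4 * (y :: padic2) \<Longrightarrow> x = y"
proof (rule padic2_eqI)
  fix n assume "4 * x = 4 * y"
  then have "residue (4 * x) (n + 2) = residue (4 * y) (n + 2)" by simp
  then have "(4 * residue x (n + 2)) mod (4 * 2 ^ n) = (4 * residue y (n + 2)) mod (4 * 2 ^ n)"
    by (simp only: residue_mult residue_numeral mod_mult_left_eq power_add) (simp add: mult.commute)
  then have "4 * (residue x (n + 2) mod 2 ^ n) = 4 * (residue y (n + 2) mod 2 ^ n)"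
    by (simp only: mult_mod_right)
  then have "residue x (n + 2) mod 2 ^ n = residue y (n + 2) mod 2 ^ n" by simp
  then show "residue x n = residue y n" by (simp add: residue_le_mod)
qed

text \<open>Division with remainder by 4 is unique, which makes the description by \<open>THE\<close> in \<open>rho\<close> meaningful
  and computes \<open>rho\<close> whenever a decomposition is at hand.\<close>

lemma rho_eqI: "x = of_nat a + 4 * y \<Longrightarrow> a < 4 \<Longrightarrow> digit x = a \<and> rho x = y"
proof -
  assume x: "x = of_nat a + 4 * y" and a: "a < 4"
  have "residue x 2 = (int a mod 4 + (4 * residue y 2) mod 4) mod 4"
    by (simp add: x residue_simps residue_numeral residue_of_nat)
  also have "\<dots> = int a" using a by simp
  finally have r: "residue x 2 = int a" .
  have "rho x = y" unfolding rho_def r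
    by (rule the_equality) (auto simp: x intro: four_mult_inject)
  then show ?thesis by (simp add: digit_def r)
qed

text \<open>The quotient has the residues of \<open>x\<close> at level \<open>n + 2\<close>, divided by 4.\<close>

lemma ex_div_four: "\<exists>y. x = of_nat (digit x) + 4 * y"
proof -
  define f where "f n = residue x (n + 2) div 4" for n
  define y where "y = Abs_padic2 (\<lambda>n. f n mod 2 ^ n)"
  have split: "residue x (n + 2) = int (digit x) + 4 * f n" for n
  proof -
    have "residue x (n + 2) mod 2 ^ 2 = residue x 2"
      by (rule residue_le_mod) simp
    then have "residue x (n + 2) mod 4 = int (digit x)" by (simp only: of_nat_digit) simp
    then show ?thesis unfolding f_def by presburger
  qed
  have "residue y n = f n mod 2 ^ n" for n
    unfolding y_def
  proof (rule residue_Abs_padic2)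
    fix n
    have "residue x (Suc n + 2) mod 2 ^ (n + 2) = residue x (n + 2)"
      by (rule residue_le_mod) simp
    then have "residue x (Suc n + 2) mod 2 ^ (n + 2) = residue x (n + 2) mod 2 ^ (n + 2)"
      by (simp only: residue_mod)
    then have "(2::int) ^ (n + 2) dvd residue x (Suc n + 2) - residue x (n + 2)"
      by (simp only: mod_eq_dvd_iff)
    then have "(4 * 2 ^ n :: int) dvd 4 * (f (Suc n) - f n)"
      unfolding split by (simp add: power_add algebra_simps)
    then have "2 ^ n dvd f (Suc n) - f n"
      by (simp only: dvd_mult_cancel_left) simp
    then show "f (Suc n) mod 2 ^ n = f n mod 2 ^ n"
      by (simp only: mod_eq_dvd_iff)
  qed
  then have "residue (of_nat (digit x) + 4 * y) n = residue x n" for n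
    using split[of n] residue_le_mod[of n "n + 2" x]
    by (simp add: residue_simps residue_numeral residue_of_nat mod_simps)
  then have "x = of_nat (digit x) + 4 * y" by (intro padic2_eqI) simp
  then show ?thesis ..
qed

lemma digit_rho: "x = of_nat (digit x) + 4 * rho x"
  using ex_div_four[of x] rho_eqI[of x] digit_less by metis

lemma digit_add_one:
  assumes "digit x < 3" shows "digit (x + 1) = Suc (digit x)" "rho (x + 1) = rho x"
proof -
  have "x + 1 = of_nat (Suc (digit x)) + 4 * rho x"
    by (subst digit_rho[of x]) simp
  from rho_eqI[OF this] assms show "digit (x + 1) = Suc (digit x)" "rho (x + 1) = rho x"
    by auto
qed

lemma digit_carry:
  assumes "digit x = 3" shows "digit (x + 1) = 0" "rho (x + 1) = rho x + 1"
proof -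
  have "x + 1 = of_nat 0 + 4 * (rho x + 1)"
    by (subst digit_rho[of x]) (simp add: assms algebra_simps)
  from rho_eqI[OF this] show "digit (x + 1) = 0" "rho (x + 1) = rho x + 1"
    by auto
qed

text \<open>Modulo \<open>2 ^ n\<close> already \<open>n\<close> base-4 digits are more than enough, so the same bound can
  serve for the number of summands and for the modulus.\<close>

definition of_digits :: "(nat \<Rightarrow> nat) \<Rightarrow> padic2" where
  "of_digits e = Abs_padic2 (\<lambda>n. (\<Sum>i<n. int (e i) * 4 ^ i) mod 2 ^ n)"

lemma residue_of_digits:
  "residue (of_digits e) n = (\<Sum>i<n. int (e i) * 4 ^ i) mod 2 ^ n"
  unfolding of_digits_def
proof (rule residue_Abs_padic2)
  fix n
  have "(2::int) ^ n dvd int (e n) * 4 ^ n"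
    by (intro dvd_mult) (simp add: dvd_power_same)
  then show "(\<Sum>i<Suc n. int (e i) * 4 ^ i) mod 2 ^ n = (\<Sum>i<n. int (e i) * 4 ^ i) mod 2 ^ n"
    by (simp add: mod_eq_dvd_iff)
qed

lemma of_digits_rec: "of_digits e = of_nat (e 0) + 4 * of_digits (\<lambda>i. e (Suc i))"
proof (rule padic2_eqI)
  fix n
  have "residue (of_nat (e 0) + 4 * of_digits (\<lambda>i. e (Suc i))) n
      = (int (e 0) + 4 * (\<Sum>i<n. int (e (Suc i)) * 4 ^ i)) mod 2 ^ n"
    by (simp add: residue_simps residue_numeral residue_of_nat residue_of_digits mod_simps)
  also have "int (e 0) + 4 * (\<Sum>i<n. int (e (Suc i)) * 4 ^ i) = (\<Sum>i<Suc n. int (e i) * 4 ^ i)"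
    by (simp add: sum.lessThan_Suc_shift sum_distrib_left algebra_simps del: sum.lessThan_Suc)
  also have "\<dots> mod 2 ^ n = residue (of_digits e) (Suc n) mod 2 ^ n"
    unfolding residue_of_digits by (simp add: mod_mod_cancel)
  finally show "residue (of_digits e) n = residue (of_nat (e 0) + 4 * of_digits (\<lambda>i. e (Suc i))) n"
    by (simp add: residue_Suc_mod)
qed

lemma of_digits_simps:
  assumes "e 0 < 4" shows "digit (of_digits e) = e 0" "rho (of_digits e) = of_digits (\<lambda>i. e (Suc i))"
  using rho_eqI[OF of_digits_rec[of e] assms] by auto

text \<open>Levels advance by two because one base-4 digit consists of two bits.\<close>

lemma residue_rec: "residue x (2 * Suc n) = int (digit x) + 4 * residue (rho x) (2 * n)"
proof -
  have "residue x (2 * Suc n) = (int (digit x) + 4 * residue (rho x) (2 * Suc n)) mod 2 ^ (2 * Suc n)"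
    by (subst digit_rho[of x])
      (simp only: residue_simps residue_numeral residue_of_nat mod_simps of_nat_numeral)
  also have "\<dots> = (int (digit x) + (4 * residue (rho x) (2 * Suc n)) mod (4 * 2 ^ (2 * n))) mod 2 ^ (2 * Suc n)"
  proof -
    have "(2 :: int) ^ (2 * Suc n) = 4 * 2 ^ (2 * n)" by simp
    then show ?thesis by (simp only: mod_add_right_eq)
  qed
  also have "(4 * residue (rho x) (2 * Suc n)) mod (4 * 2 ^ (2 * n)) =
      4 * (residue (rho x) (2 * Suc n) mod 2 ^ (2 * n))"
    by (simp only: mult_mod_right)
  also have "residue (rho x) (2 * Suc n) mod 2 ^ (2 * n) = residue (rho x) (2 * n)"
    by (rule residue_le_mod) simp
  also have "(int (digit x) + 4 * residue (rho x) (2 * n)) mod 2 ^ (2 * Suc n)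
      = int (digit x) + 4 * residue (rho x) (2 * n)"
    using digit_less[of x] residue_range[of "rho x" "2 * n"] by simp
  finally show ?thesis .
qed

section \<open>Cylinders generate the Borel sets\<close>

text \<open>Only even levels are used: a cylinder of level \<open>2 n\<close> prescribes exactly the first \<open>n\<close> base-4
  digits.\<close>

definition cylinder :: "nat \<Rightarrow> int \<Rightarrow> padic2 set" where
  "cylinder n r = {x. residue x (2 * n) = r}"

lemma of_digits_digits: "of_digits (\<lambda>i. digit ((rho ^^ i) x)) = x"
proof -
  have "residue (of_digits (\<lambda>i. digit ((rho ^^ i) x))) (2 * n) = residue x (2 * n)" for n
  proof (induction n arbitrary: x)
    case (Suc n)
    have "residue (of_digits (\<lambda>i. digit ((rho ^^ i) x))) (2 * Suc n) =
      int (digit x) + 4 * residue (of_digits (\<lambda>i. digit ((rho ^^ i) (rho x)))) (2 * n)"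
      unfolding residue_rec by (simp add: of_digits_simps digit_less funpow_swap1)
    then show ?case using Suc[of "rho x"] residue_rec[of x n] by simp
  qed simp
  note even = this
  show ?thesis
  proof (rule padic2_eqI)
    fix n show "residue (of_digits (\<lambda>i. digit ((rho ^^ i) x))) n = residue x n"
      using even[of n] by (rule residue_eq_mono) simp
  qed
qed

lemma cylinder_Suc:
  "cylinder (Suc n) r = {x. int (digit x) = r mod 4 \<and> rho x \<in> cylinder n (r div 4)}"
proof -
  have "int (digit x) + 4 * s = r \<longleftrightarrow> int (digit x) = r mod 4 \<and> s = r div 4" for x s
    using digit_less[of x] by auto
  then show ?thesis unfolding cylinder_def residue_rec by blast
qed

lemma open_cylinder: "open (cylinder n r)"
  unfolding open_padic2_def cylinder_def by auto

lemma borel_cylinder [measurable]: "cylinder n r \<in> sets borel"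
  using open_cylinder by (rule borel_open)

lemma cylinder_empty: "r \<notin> {0..<4 ^ n} \<Longrightarrow> cylinder n r = {}"
  using residue_range[of _ "2 * n"] by (auto simp: cylinder_def power_mult)

definition cylinders :: "padic2 set set" where
  "cylinders = range (\<lambda>(n, r). cylinder n r)"

lemma cylinder_subset: "residue x (2 * n) = r \<Longrightarrow> n \<le> m \<Longrightarrow> cylinder m (residue x (2 * m)) \<subseteq> cylinder n r"
  unfolding cylinder_def by (blast intro: residue_eq_mono[of _ "2 * m" _ "2 * n"] mult_le_mono2)

lemma countable_cylinders: "countable cylinders"
  unfolding cylinders_def by (rule countable_image) (rule countableI_type)

lemma cylinder_in_cylinders [intro, simp]: "cylinder n r \<in> cylinders"
  unfolding cylinders_def by (rule image_eqI[of _ _ "(n, r)"]) simp_all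

lemma Int_stable_cylinders: "Int_stable cylinders"
proof (rule Int_stableI)
  have *: "cylinder n r \<inter> cylinder m s \<in> cylinders" if "n \<le> m" for n m r s
  proof (cases "cylinder n r \<inter> cylinder m s = {}")
    case True
    then have "cylinder n r \<inter> cylinder m s = cylinder 0 1"
      using cylinder_empty[of 1 0] by simp
    then show ?thesis by simp
  next
    case False
    then obtain x where "x \<in> cylinder n r" "x \<in> cylinder m s" by blast
    then have "cylinder m s \<subseteq> cylinder n r" using cylinder_subset[OF _ that] by (auto simp: cylinder_def)
    then have "cylinder n r \<inter> cylinder m s = cylinder m s" by blast
    then show ?thesis by simp
  qed
  fix a b assume "a \<in> cylinders" "b \<in> cylinders"
  then obtain n r m s where ab: "a = cylinder n r" "b = cylinder m s"
    unfolding cylinders_def by auto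
  show "a \<inter> b \<in> cylinders"
  proof (cases "n \<le> m")
    case False
    then show ?thesis using *[of m n s r] by (simp add: ab Int_commute)
  qed (use * ab in simp)
qed

lemma borel_eq_cylinders: "sets (borel :: padic2 measure) = sigma_sets UNIV cylinders"
proof
  have "a \<in> sigma_sets UNIV cylinders" if "open a" for a :: "padic2 set"
  proof -
    have "\<exists>c\<in>cylinders. x \<in> c \<and> c \<subseteq> a" if x: "x \<in> a" for x
    proof -
      obtain n where n: "\<And>y. residue y n = residue x n \<Longrightarrow> y \<in> a"
        using \<open>open a\<close> x unfolding open_padic2_def by blast
      have "cylinder n (residue x (2 * n)) \<subseteq> a"
      proof
        fix y assume "y \<in> cylinder n (residue x (2 * n))"
        then have "residue y (2 * n) = residue x (2 * n)" by (simp add: cylinder_def)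
        then have "residue y n = residue x n" by (rule residue_eq_mono) simp
        then show "y \<in> a" by (rule n)
      qed
      moreover have "x \<in> cylinder n (residue x (2 * n))" by (simp add: cylinder_def)
      ultimately show ?thesis by blast
    qed
    then have "a = \<Union>{c \<in> cylinders. c \<subseteq> a}" by blast
    moreover have "\<Union>{c \<in> cylinders. c \<subseteq> a} \<in> sigma_sets UNIV cylinders"
      by (intro sigma_sets_UNION countable_subset[OF _ countable_cylinders]) auto
    ultimately show ?thesis by simp
  qed
  then show "sets (borel :: padic2 measure) \<subseteq> sigma_sets UNIV cylinders"
    unfolding borel_def by (subst sets_measure_of) (auto intro!: sigma_sets_mono)
  show "sigma_sets UNIV cylinders \<subseteq> sets (borel :: padic2 measure)"
    using sets.sigma_sets_subset[of cylinders "borel :: padic2 measure"]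
    by (simp add: cylinders_def image_subset_iff)
qed

lemma measurable_into_padic2:
  assumes "\<And>n r. f -` cylinder n r \<inter> space M \<in> sets M"
  shows "f \<in> M \<rightarrow>\<^sub>M (borel :: padic2 measure)"
proof (rule measurable_sigma_sets[OF borel_eq_cylinders])
  show "f -` y \<inter> space M \<in> sets M" if "y \<in> cylinders" for y
    using assms that unfolding cylinders_def by auto
qed auto

lemma measurable_residue [measurable]: "(\<lambda>x. residue x n) \<in> borel \<rightarrow>\<^sub>M count_space UNIV"
proof (rule measurable_count_space_eq2_countable[THEN iffD2])
  have "open ((\<lambda>x. residue x n) -` {a})" for a
    unfolding open_padic2_def by auto
  then show "(\<lambda>x. residue x n) \<in> space borel \<rightarrow> UNIV \<and>
      (\<forall>a\<in>UNIV. (\<lambda>x. residue x n) -` {a} \<inter> space borel \<in> sets borel)" by auto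
qed

lemma measurable_digit [measurable]: "digit \<in> borel \<rightarrow>\<^sub>M count_space UNIV"
  unfolding digit_def by measurable

lemma measurable_rho [measurable]: "rho \<in> borel \<rightarrow>\<^sub>M borel"
proof (rule measurable_into_padic2)
  fix n r
  have "rho -` cylinder n r = (\<Union>i<4. cylinder (Suc n) (4 * r + int i))"
  proof (intro set_eqI iffI)
    fix x assume "x \<in> rho -` cylinder n r"
    then have "x \<in> cylinder (Suc n) (4 * r + int (digit x))"
      unfolding cylinder_def using residue_rec[of x n] by simp
    then show "x \<in> (\<Union>i<4. cylinder (Suc n) (4 * r + int i))" using digit_less[of x] by blast
  qed (auto simp: cylinder_Suc)
  then show "rho -` cylinder n r \<inter> space borel \<in> sets borel" by simp
qed

text \<open>Translations permute the cylinders of each level; this is what forces an invariant measure to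
  give all of them the same mass.\<close>

lemma translate_cylinder:
  "(\<lambda>x. a + x) ` cylinder n r = cylinder n ((r + residue a (2 * n)) mod 4 ^ n)" if "r \<in> {0..<4 ^ n}"
proof (intro set_eqI iffI)
  fix y assume "y \<in> cylinder n ((r + residue a (2 * n)) mod 4 ^ n)"
  then have "residue (y - a) (2 * n) = r"
    using that by (simp add: cylinder_def residue_simps mod_simps power_mult)
  then show "y \<in> (\<lambda>x. a + x) ` cylinder n r"
    by (intro image_eqI[of _ _ "y - a"]) (auto simp: cylinder_def)
qed (auto simp: cylinder_def residue_simps power_mult add.commute)

lemma translate_vimage: "(\<lambda>x. a + x) -` E = (\<lambda>x. - a + x) ` (E :: padic2 set)"
  by (force simp: image_iff intro: bexI[of _ "a + _"])

lemma measurable_translate [measurable]: "(\<lambda>x. a + x) \<in> borel \<rightarrow>\<^sub>M (borel :: padic2 measure)"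
proof (rule measurable_into_padic2)
  fix n r
  have "(\<lambda>x. a + x) -` cylinder n r = (\<lambda>x. - a + x) ` cylinder n r"
    by (rule translate_vimage)
  then show "(\<lambda>x. a + x) -` cylinder n r \<inter> space borel \<in> sets borel"
    using translate_cylinder[of r n "-a"] cylinder_empty[of r n] by (cases "r \<in> {0..<4 ^ n}") auto
qed

text \<open>Cylinders are nested or disjoint and generate the Borel sets, so a probability measure is
  determined by their masses.\<close>

lemma padic2_measure_eqI:
  assumes "sets M = sets borel" "sets N = sets borel" "prob_space M"
    and eq: "\<And>n r. r \<in> {0..<4 ^ n} \<Longrightarrow> emeasure M (cylinder n r) = emeasure N (cylinder n r)"
  shows "M = N"
proof (rule measure_eqI_generator_eq[OF Int_stable_cylinders, where A="\<lambda>_. cylinder 0 0"])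
  show "emeasure M (cylinder 0 0) \<noteq> \<infinity>"
    using prob_space.emeasure_le_1[OF assms(3), of "cylinder 0 0"] by (auto simp: top_unique)
  show "emeasure M X = emeasure N X" if X: "X \<in> cylinders" for X
  proof -
    obtain n r where "X = cylinder n r" using X by (auto simp: cylinders_def image_iff)
    then show ?thesis
      using eq[of r n] cylinder_empty[of r n] by (cases "r \<in> {0..<4 ^ n}") auto
  qed
  show "(\<Union>i::nat. cylinder 0 0) = UNIV" by (simp add: cylinder_def)
qed (use assms borel_eq_cylinders in auto)

section \<open>Haar measure makes the digits independent and uniform\<close>

definition is_haar :: "padic2 measure \<Rightarrow> bool" where
  "is_haar M \<longleftrightarrow> sets M = sets borel \<and> prob_space M \<and>
     (\<forall>a. \<forall>A\<in>sets borel. emeasure M ((\<lambda>x. a + x) ` A) = emeasure M A)"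

lemma UN_cylinder: "(\<Union>r\<in>{0..<4 ^ n}. cylinder n r) = UNIV"
  using residue_range[of _ "2 * n"] by (auto simp: cylinder_def power_mult)

lemma emeasure_haar_cylinder:
  assumes M: "is_haar M" and r: "r \<in> {0..<4 ^ n}"
  shows "emeasure M (cylinder n r) = ennreal ((1 / 4) ^ n)"
proof -
  interpret prob_space M using M by (simp add: is_haar_def)
  have s [simp]: "sets M = sets borel" using M by (simp add: is_haar_def)
  have eq: "measure M (cylinder n r) = measure M (cylinder n 0)" if "r \<in> {0..<4 ^ n}" for r
  proof -
    have "residue (of_int r :: padic2) (2 * n) = r"
      using residue_of_nat[of "nat r" "2 * n"] that
      by (simp add: power_mult)
    then have "(\<lambda>x. of_int r + x) ` cylinder n 0 = cylinder n r"
      using translate_cylinder[of 0 n "of_int r"] that by simp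
    then have "emeasure M (cylinder n r) = emeasure M (cylinder n 0)"
      using M unfolding is_haar_def by (metis borel_cylinder)
    then show ?thesis by (simp add: measure_def)
  qed
  have "(\<Sum>r\<in>{0..<4 ^ n}. measure M (cylinder n r)) = 1"
  proof -
    have "(\<Sum>r\<in>{0..<4 ^ n}. measure M (cylinder n r)) = measure M (\<Union>r\<in>{0..<4 ^ n}. cylinder n r)"
      by (rule finite_measure_finite_Union[symmetric])
        (auto simp: disjoint_family_on_def cylinder_def[symmetric], auto simp: cylinder_def)
    then show ?thesis using UN_cylinder[of n] prob_space s
      by (metis space_borel sets_eq_imp_space_eq)
  qed
  moreover have "(\<Sum>r\<in>{0..<4 ^ n}. measure M (cylinder n r)) = (\<Sum>r\<in>{0..<4 ^ n :: int}. measure M (cylinder n 0))"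
    by (intro sum.cong refl eq)
  ultimately have "4 ^ n * measure M (cylinder n 0) = 1"
    by simp
  then have "measure M (cylinder n r) = (1 / 4) ^ n"
    using eq[OF r] by (simp add: field_simps)
  then show ?thesis by (simp add: emeasure_eq_measure)
qed

text \<open>Independent uniform base-4 digits, as a model from which Haar measure is constructed.\<close>

definition digit_measure :: "(nat \<Rightarrow> nat) measure" where
  "digit_measure = PiM UNIV (\<lambda>_. measure_pmf (pmf_of_set {..<4}))"

lemma prob_space_digit_measure: "prob_space digit_measure"
  unfolding digit_measure_def by (intro prob_space_PiM measure_pmf.prob_space_axioms)

lemma AE_digit_measure: "AE e in digit_measure. \<forall>i. e i < 4"
  unfolding AE_all_countable
proof
  fix i :: nat
  have "AE k in measure_pmf (pmf_of_set {..<4::nat}). k < 4"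
    by (subst AE_measure_pmf_iff) (simp add: set_pmf_of_set lessThan_empty_iff)
  then show "AE e in digit_measure. e i < 4"
    unfolding digit_measure_def
    by (intro AE_PiM_component[where P="\<lambda>k. k < 4"] measure_pmf.prob_space_axioms) auto
qed

lemma measurable_digit_component [measurable]: "(\<lambda>e. e i) \<in> digit_measure \<rightarrow>\<^sub>M count_space UNIV"
  using measurable_component_singleton[of i UNIV "\<lambda>_. measure_pmf (pmf_of_set {..<4})"]
  unfolding digit_measure_def by simp

lemma measurable_of_digits:
  assumes "\<And>i. (\<lambda>z. e z i) \<in> M \<rightarrow>\<^sub>M count_space UNIV"
  shows "(\<lambda>z. of_digits (e z)) \<in> M \<rightarrow>\<^sub>M borel"
proof (rule measurable_into_padic2)
  fix n r
  have [measurable]: "(\<lambda>z. \<Sum>i<n. int (e z i) * 4 ^ i) \<in> M \<rightarrow>\<^sub>M count_space UNIV" for n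
  proof (induction n)
    case (Suc n)
    have "(\<lambda>z. (\<Sum>i<n. int (e z i) * 4 ^ i) + int k * 4 ^ n) \<in> M \<rightarrow>\<^sub>M count_space UNIV" for k
      using Suc by (rule measurable_compose) simp
    from measurable_compose_countable[OF this assms] show ?case by simp
  qed simp
  have "{z \<in> space M. (\<Sum>i<2 * n. int (e z i) * 4 ^ i) mod 2 ^ (2 * n) = r} \<in> sets M"
    by measurable
  then show "(\<lambda>z. of_digits (e z)) -` cylinder n r \<inter> space M \<in> sets M"
    by (simp add: cylinder_def residue_of_digits vimage_def Int_def conj_commute)
qed

text \<open>Membership in a cylinder fixes the first \<open>n\<close> digits one by one, which turns its mass into a
  product.\<close>

lemma of_digits_in_cylinder:
  assumes "\<And>i. e i < 4" "r \<in> {0..<4 ^ n}"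
  shows "of_digits e \<in> cylinder n r \<longleftrightarrow> (\<forall>i<n. e i = nat (r div 4 ^ i mod 4))"
  using assms
proof (induction n arbitrary: e r)
  case 0
  then show ?case by (simp add: cylinder_def)
next
  case (Suc n)
  have "of_digits e \<in> cylinder (Suc n) r \<longleftrightarrow>
     e 0 = nat (r mod 4) \<and> of_digits (\<lambda>i. e (Suc i)) \<in> cylinder n (r div 4)"
    using Suc.prems by (auto simp: cylinder_Suc of_digits_simps)
  also have "\<dots> \<longleftrightarrow> e 0 = nat (r mod 4) \<and> (\<forall>i<n. e (Suc i) = nat (r div 4 div 4 ^ i mod 4))"
    using Suc.prems by (subst Suc.IH) auto
  also have "\<dots> \<longleftrightarrow> (\<forall>i<Suc n. e i = nat (r div 4 ^ i mod 4))"
    unfolding All_less_Suc2 by (simp add: zdiv_zmult2_eq)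
  finally show ?case .
qed

definition haar_model :: "padic2 measure" where
  "haar_model = distr digit_measure borel of_digits"

lemma sets_haar_model [simp, measurable_cong]: "sets haar_model = sets borel"
  by (simp add: haar_model_def)

lemma measurable_of_digits' [measurable]: "of_digits \<in> digit_measure \<rightarrow>\<^sub>M borel"
  using measurable_of_digits[of "\<lambda>e. e" digit_measure] by simp

lemma prob_space_haar_model: "prob_space haar_model"
  unfolding haar_model_def
  by (rule prob_space.prob_space_distr[OF prob_space_digit_measure]) measurable

lemma emeasure_haar_model_cylinder:
  assumes "r \<in> {0..<4 ^ n}"
  shows "emeasure haar_model (cylinder n r) = ennreal ((1 / 4) ^ n)"
proof -
  let ?p = "measure_pmf (pmf_of_set {..<4::nat})"
  interpret product_prob_space "\<lambda>_::nat. ?p" UNIV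
    by (intro product_prob_spaceI measure_pmf.prob_space_axioms)
  define X where "X i = {nat (r div 4 ^ i mod 4)}" for i :: nat
  have "emeasure haar_model (cylinder n r) = emeasure digit_measure (of_digits -` cylinder n r \<inter> space digit_measure)"
    unfolding haar_model_def by (subst emeasure_distr) auto
  also have "\<dots> = emeasure digit_measure {e \<in> space digit_measure. \<forall>i\<in>{..<n}. e i \<in> X i}"
  proof (rule emeasure_eq_AE)
    show "AE e in digit_measure. e \<in> of_digits -` cylinder n r \<inter> space digit_measure \<longleftrightarrow>
       e \<in> {e \<in> space digit_measure. \<forall>i\<in>{..<n}. e i \<in> X i}"
      using AE_digit_measure
      by eventually_elim (auto simp: of_digits_in_cylinder[OF _ assms] X_def)
    show "of_digits -` cylinder n r \<inter> space digit_measure \<in> sets digit_measure"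
      by (rule measurable_sets[OF measurable_of_digits']) simp
    show "{e \<in> space digit_measure. \<forall>i\<in>{..<n}. e i \<in> X i} \<in> sets digit_measure"
      by measurable
  qed
  also have "\<dots> = (\<Prod>i<n. emeasure ?p (X i))"
    unfolding digit_measure_def by (rule emeasure_PiM_Collect) auto
  also have "\<dots> = (\<Prod>i<n. ennreal (1 / 4))"
  proof (rule prod.cong)
    fix i
    have "nat (r div 4 ^ i mod 4) < 4"
      by (simp add: nat_less_iff)
    then show "emeasure ?p (X i) = ennreal (1 / 4)"
      by (simp add: X_def emeasure_pmf_single pmf_of_set lessThan_empty_iff)
  qed simp
  also have "\<dots> = ennreal ((1 / 4) ^ n)"
    by (simp add: ennreal_power)
  finally show ?thesis .
qed

text \<open>Translations only permute cylinders of equal mass, so the image under a translation has the same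
  cylinder masses and is the same measure.\<close>

lemma is_haar_model: "is_haar haar_model"
  unfolding is_haar_def
proof (intro conjI allI ballI)
  fix a and E :: "padic2 set" assume E: "E \<in> sets borel"
  have "distr haar_model borel (\<lambda>x. - a + x) = haar_model"
  proof (rule padic2_measure_eqI)
    show "prob_space (distr haar_model borel (\<lambda>x. - a + x))"
      by (rule prob_space.prob_space_distr[OF prob_space_haar_model]) measurable
    fix n r assume r: "r \<in> {0..<4 ^ n :: int}"
    have vim: "(\<lambda>x. - a + x) -` cylinder n r = (\<lambda>x. a + x) ` cylinder n r"
      using translate_vimage[of "- a"] by simp
    have "emeasure (distr haar_model borel (\<lambda>x. - a + x)) (cylinder n r) =
        emeasure haar_model ((\<lambda>x. - a + x) -` cylinder n r)"
      by (subst emeasure_distr) (auto simp: sets_eq_imp_space_eq[OF sets_haar_model])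
    also have "\<dots> = emeasure haar_model (cylinder n ((r + residue a (2 * n)) mod 4 ^ n))"
      by (simp only: vim translate_cylinder[OF r])
    also have "\<dots> = emeasure haar_model (cylinder n r)"
      using r by (simp add: emeasure_haar_model_cylinder)
    finally show "emeasure (distr haar_model borel (\<lambda>x. - a + x)) (cylinder n r) =
        emeasure haar_model (cylinder n r)" .
  qed auto
  then have "emeasure haar_model E = emeasure (distr haar_model borel (\<lambda>x. - a + x)) E" by simp
  also have "\<dots> = emeasure haar_model ((\<lambda>x. - a + x) -` E)"
    using E by (subst emeasure_distr) (auto simp: sets_eq_imp_space_eq[OF sets_haar_model])
  also have "(\<lambda>x. - a + x) -` E = (\<lambda>x. a + x) ` E"
    using translate_vimage[of "- a"] by simp
  finally show "emeasure haar_model ((\<lambda>x. a + x) ` E) = emeasure haar_model E" by simp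
qed (auto simp: prob_space_haar_model)

lemma padic2_haar_eq: "padic2_haar = haar_model"
  unfolding padic2_haar_def is_haar_def[symmetric]
proof (rule the_equality)
  fix M assume M: "is_haar M"
  show "M = haar_model"
    using M by (intro padic2_measure_eqI)
      (auto simp: is_haar_def emeasure_haar_cylinder emeasure_haar_model_cylinder)
qed (rule is_haar_model)

lemma sets_haar [simp, measurable_cong]: "sets padic2_haar = sets borel"
  by (simp add: padic2_haar_eq)

lemma space_haar [simp]: "space padic2_haar = UNIV"
  using sets_eq_imp_space_eq[OF sets_haar] by simp

lemma prob_space_haar: "prob_space padic2_haar"
  by (simp add: padic2_haar_eq prob_space_haar_model)

interpretation haar: prob_space padic2_haar
  by (rule prob_space_haar)

lemma haar_translate:
  "distr padic2_haar borel (\<lambda>x. x + a) = padic2_haar"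
proof (rule measure_eqI)
  fix E assume E: "E \<in> sets (distr padic2_haar borel (\<lambda>x. x + a))"
  have m: "(\<lambda>x. x + a) \<in> borel \<rightarrow>\<^sub>M borel"
    using measurable_translate[of a] by (simp add: add.commute)
  have "emeasure (distr padic2_haar borel (\<lambda>x. x + a)) E = emeasure padic2_haar ((\<lambda>x. x + a) -` E)"
    using E m by (subst emeasure_distr) auto
  also have "(\<lambda>x. x + a) -` E = (\<lambda>x. - a + x) ` E"
    using translate_vimage[of a E] by (simp only: add.commute[of _ a])
  also have "emeasure padic2_haar \<dots> = emeasure padic2_haar E"
    using is_haar_model E unfolding is_haar_def padic2_haar_eq[symmetric]
    by (simp del: uminus_add_conv_diff)
  finally show "emeasure (distr padic2_haar borel (\<lambda>x. x + a)) E = emeasure padic2_haar E" .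
qed simp

text \<open>The lowest digit is uniform and independent of the remaining ones. Fixing the digit \<open>i\<close> turns a
  cylinder of level \<open>n\<close> for \<open>rho x\<close> into a cylinder of level \<open>n + 1\<close> for \<open>x\<close>, so the conditional law of
  \<open>rho x\<close> has the cylinder masses of Haar measure.\<close>

lemma haar_digit_rho:
  assumes "i < 4" "E \<in> sets borel"
  shows "measure padic2_haar {x. digit x = i \<and> rho x \<in> E} = measure padic2_haar E / 4"
proof -
  let ?D = "{x. digit x = i}"
  have D [measurable]: "?D \<in> sets borel" by measurable
  \<comment> \<open>the conditional law of \<open>rho x\<close> given that the digit is \<open>i\<close>\<close>
  define N where "N = scale_measure 4 (distr (restrict_space padic2_haar ?D) borel rho)"
  have rr: "rho \<in> restrict_space padic2_haar ?D \<rightarrow>\<^sub>M borel"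
    by (intro measurable_restrict_space1) simp
  have N: "emeasure N F = 4 * emeasure padic2_haar {x. digit x = i \<and> rho x \<in> F}" if "F \<in> sets borel" for F
    unfolding N_def using that rr
    by (simp add: emeasure_distr emeasure_restrict_space space_restrict_space)
       (rule arg_cong[where f="\<lambda>S. 4 * emeasure padic2_haar S"], auto)
  have "padic2_haar = N"
  proof (rule padic2_measure_eqI)
    fix n r assume r: "r \<in> {0..<4 ^ n :: int}"
    have "{x. digit x = i \<and> rho x \<in> cylinder n r} = cylinder (Suc n) (4 * r + int i)"
      using assms by (auto simp: cylinder_Suc)
    moreover have "4 * r + int i \<in> {0..<4 ^ Suc n}" using r assms by auto
    ultimately have "emeasure N (cylinder n r) = 4 * ennreal ((1 / 4) ^ Suc n)"
      by (subst N) (simp_all only: borel_cylinder emeasure_haar_model_cylinder padic2_haar_eq)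
    also have "\<dots> = ennreal (4 * (1 / 4) ^ Suc n)"
      by (subst ennreal_mult'') auto
    also have "\<dots> = emeasure padic2_haar (cylinder n r)"
      using r by (simp add: padic2_haar_eq emeasure_haar_model_cylinder)
    finally show "emeasure padic2_haar (cylinder n r) = emeasure N (cylinder n r)" by simp
  qed (auto simp: N_def prob_space_haar)
  then have "emeasure padic2_haar E = 4 * emeasure padic2_haar {x. digit x = i \<and> rho x \<in> E}"
    using N[OF assms(2)] by simp
  then show ?thesis
    by (simp add: measure_def enn2real_mult)
qed

lemma Union_digit: "E = (\<Union>i<4. {x. digit x = i \<and> x \<in> E})"
  using digit_less by blast

lemma measure_sum_digit:
  assumes "E \<in> sets borel"
  shows "measure padic2_haar E = (\<Sum>i<4. measure padic2_haar {x. digit x = i \<and> x \<in> E})"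
  using assms by (subst Union_digit, subst haar.finite_measure_finite_Union)
    (auto simp: disjoint_family_on_def)

lemma haar_rho:
  assumes [measurable]: "E \<in> sets borel" shows "measure padic2_haar (rho -` E) = measure padic2_haar E"
proof -
  have "measure padic2_haar (rho -` E) = (\<Sum>i<4. measure padic2_haar {x. digit x = i \<and> rho x \<in> E})"
    using measurable_sets[OF measurable_rho assms] by (subst measure_sum_digit) auto
  then show ?thesis by (simp add: haar_digit_rho)
qed

section \<open>The golden ratio in the pentagon\<close>

text \<open>All coefficients lie in \<open>\<int>[g]\<close>, and \<open>g * g = 1 - g\<close> keeps computations linear in \<open>g\<close>;
  this is why the inverse of the golden ratio is used instead of \<open>\<omega>\<close> itself.\<close>

definition g :: real where "g = 1 / omega"

lemma g_pos: "g > 0" and g_square: "g * g = 1 - g" and omega_pos: "omega > 0"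
proof -
  show o: "omega > 0" unfolding omega_def by (simp add: add_pos_nonneg)
  have "omega * omega = omega + 1"
    unfolding omega_def by (simp add: field_simps)
  moreover have "g * omega = 1" using o by (simp add: g_def)
  ultimately show "g * g = 1 - g" by algebra
  show "g > 0" using o by (simp add: g_def)
qed

lemma g_bounds: "1 / 2 < g" "g < 2 / 3"
proof -
  show "1 / 2 < g"
  proof (rule ccontr)
    assume "\<not> 1 / 2 < g"
    then have "g * g \<le> (1 / 2) * (1 / 2)" using g_pos by (intro mult_mono) auto
    then show False using g_square \<open>\<not> 1 / 2 < g\<close> by simp
  qed
  show "g < 2 / 3"
  proof (rule ccontr)
    assume "\<not> g < 2 / 3"
    then have "(2 / 3) * (2 / 3) \<le> g * g" by (intro mult_mono) auto
    then show False using g_square \<open>\<not> g < 2 / 3\<close> by simp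
  qed
qed

lemma g_square_left: "g * (g * u) = u - g * u"
  using g_square by (metis left_diff_distrib mult.assoc mult_1)

lemma omega_inverse: "inverse (omega\<^sup>2) = 1 - g"
proof -
  have "inverse (omega\<^sup>2) = g * g"
    by (simp add: g_def power2_eq_square inverse_eq_divide)
  then show ?thesis using g_square by simp
qed

lemma zeta_polar: "zeta = cis (2 * pi / 5)"
  by (simp add: zeta_def cis_conv_exp mult_ac)

lemma norm_zeta [simp]: "norm zeta = 1"
  by (simp add: zeta_polar)

lemma zeta_nonzero [simp]: "zeta \<noteq> 0"
  using norm_zeta by fastforce

lemma Im_zeta_pos: "Im zeta > 0"
  by (simp add: zeta_polar) (rule sin_gt_zero, auto)

lemma Re_zeta_pos: "Re zeta > 0"
proof -
  have "0 < cos (2 * pi / 5)" using pi_gt_zero by (intro cos_gt_zero_pi) linarith+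
  then show ?thesis by (simp add: zeta_polar)
qed

lemma zeta_power5: "zeta ^ 5 = 1"
proof -
  have "zeta ^ 5 = cis (real 5 * (2 * pi / 5))"
    unfolding zeta_polar by (rule Complex.DeMoivre)
  then show ?thesis by simp
qed

text \<open>The number \<open>\<zeta> + 1 / \<zeta>\<close> is the positive root of \<open>r\<^sup>2 + r = 1\<close>, because the fifth roots of unity
  sum to 0. This relation is the only place where the golden ratio and the pentagon meet.\<close>

lemma zeta_add_inverse: "zeta + inverse zeta = of_real g"
proof -
  define r where "r = 2 * Re zeta"
  have inv: "inverse zeta = cnj zeta"
    by (simp add: zeta_polar cis_cnj)
  have r: "zeta + inverse zeta = of_real r"
    unfolding inv r_def by (simp add: complex_eq_iff)
  have "zeta \<noteq> 1" using Im_zeta_pos by auto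
  have "(zeta - 1) * (zeta ^ 4 + zeta ^ 3 + zeta ^ 2 + zeta + 1) = zeta ^ 5 - 1"
    by (simp add: algebra_simps power_numeral_reduce)
  then have sum0: "zeta ^ 4 + zeta ^ 3 + zeta ^ 2 + zeta + 1 = 0"
    using \<open>zeta \<noteq> 1\<close> zeta_power5 by simp
  \<comment> \<open>divided by \<open>\<zeta>\<^sup>2\<close>, the cyclotomic equation becomes quadratic in \<open>\<zeta> + 1 / \<zeta>\<close>\<close>
  have "zeta\<^sup>2 * ((zeta + inverse zeta)\<^sup>2 + (zeta + inverse zeta) - 1)
      = zeta ^ 4 + zeta ^ 3 + zeta ^ 2 + zeta + 1"
    by (simp add: field_simps power_numeral_reduce power2_eq_square)
  then have "(zeta + inverse zeta)\<^sup>2 + (zeta + inverse zeta) - 1 = 0"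
    using sum0 by simp
  then have "of_real (r\<^sup>2 + r - 1) = (0 :: complex)"
    unfolding r by simp
  then have "r\<^sup>2 + r - 1 = 0"
    by (simp only: of_real_eq_0_iff)
  then have "(r - g) * (r + g + 1) = 0"
    using g_square by (simp add: algebra_simps power2_eq_square)
  moreover have "r + g + 1 > 0" using Re_zeta_pos g_pos by (simp add: r_def)
  ultimately show ?thesis using r by simp
qed

section \<open>Coordinates in which the rhombus is the unit square\<close>

definition point :: "real \<Rightarrow> real \<Rightarrow> complex" where
  "point a b = of_real a - of_real b * inverse zeta"

definition coord2 :: "complex \<Rightarrow> real" where
  "coord2 x = Im x / Im zeta"

definition coord1 :: "complex \<Rightarrow> real" where
  "coord1 x = Re x + coord2 x * Re zeta"

lemma point_Re_Im: "Re (point a b) = a - b * Re zeta" "Im (point a b) = b * Im zeta"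
proof -
  have inv: "inverse zeta = cnj zeta"
    by (simp add: zeta_polar cis_cnj)
  show "Re (point a b) = a - b * Re zeta" "Im (point a b) = b * Im zeta"
    by (simp_all add: point_def inv)
qed

lemma coord_point [simp]: "coord1 (point a b) = a" "coord2 (point a b) = b"
  using Im_zeta_pos by (simp_all add: coord1_def coord2_def point_Re_Im)

lemma point_coord: "point (coord1 x) (coord2 x) = x"
  using Im_zeta_pos by (simp add: complex_eq_iff point_Re_Im coord1_def coord2_def)

lemma point_eq_iff [simp]: "point a b = point a' b' \<longleftrightarrow> a = a' \<and> b = b'"
  by (metis coord_point)

lemma obtain_point: obtains a b where "x = point a b"
  using point_coord by metis

lemma continuous_coord: "continuous_on UNIV coord1" "continuous_on UNIV coord2"
  using Im_zeta_pos unfolding coord1_def[abs_def] coord2_def[abs_def]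
  by (auto intro!: continuous_intros)

lemma borel_measurable_coord [measurable]:
  "coord1 \<in> borel_measurable borel" "coord2 \<in> borel_measurable borel"
  using continuous_coord by (auto intro: borel_measurable_continuous_onI)

lemma zeta_eq: "zeta = point g 1"
  using zeta_add_inverse by (simp add: point_def algebra_simps)

lemma point_add: "point a b + point a' b' = point (a + a') (b + b')"
  and point_diff: "point a b - point a' b' = point (a - a') (b - b')"
  and point_scale: "of_real t * point a b = point (t * a) (t * b)"
  by (simp_all add: point_def algebra_simps)

lemma point_1: "1 = point 1 0" and point_0: "0 = point 0 0"
  by (simp_all add: point_def)

lemma point_mult_zeta: "zeta * point a b = point (g * a - b) a"
proof -
  have "zeta * point a b = of_real a * zeta - of_real b"
    by (simp add: point_def algebra_simps)
  also have "\<dots> = point (g * a - b) a"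
    unfolding zeta_eq by (simp add: point_def algebra_simps)
  finally show ?thesis .
qed

lemma point_div_zeta: "point a b / zeta = point b (g * b - a)"
proof -
  have "zeta * point b (g * b - a) = point a b"
    by (simp add: point_mult_zeta)
  then show ?thesis by (metis nonzero_mult_div_cancel_left zeta_nonzero)
qed

lemma point_div_omega2: "point a b / (of_real omega)\<^sup>2 = point ((1 - g) * a) ((1 - g) * b)"
proof -
  have "point a b / (of_real omega)\<^sup>2 = of_real (inverse (omega\<^sup>2)) * point a b"
    by (simp add: field_simps)
  then show ?thesis by (simp only: omega_inverse point_scale)
qed

lemma L_point: "point a b \<in> L \<longleftrightarrow> 0 \<le> a \<and> a < 1 \<and> 0 \<le> b \<and> b < 1"
  unfolding L_def by (auto simp flip: point_def)

lemma Delta_point: "point a b \<in> Delta \<longleftrightarrow> 0 \<le> a \<and> a < 1 \<and> b < 1 \<and> 0 \<le> b \<and> a \<le> g * b"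
  using Im_zeta_pos by (auto simp: Delta_def L_point point_div_zeta point_Re_Im zero_le_mult_iff)

lemma Z_point: "point a b \<in> Z \<longleftrightarrow> 0 \<le> a \<and> a < 1 \<and> 0 \<le> b \<and> b < 1 \<and> g * b < a"
  by (auto simp: Z_def Delta_point L_point)

lemma L'_point: "point a b \<in> L' \<longleftrightarrow> 0 \<le> a \<and> a < 1 - g \<and> 0 \<le> b \<and> b < 1 - g"
proof -
  have g1: "1 - g > 0" using g_bounds by simp
  have "point a b \<in> L' \<longleftrightarrow> (\<exists>a' b'. point a' b' \<in> L \<and> a = (1 - g) * a' \<and> b = (1 - g) * b')"
    unfolding L'_def image_iff by (metis obtain_point point_div_omega2 point_eq_iff)
  also have "\<dots> \<longleftrightarrow> point (a / (1 - g)) (b / (1 - g)) \<in> L"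
    using g1 by (metis nonzero_mult_div_cancel_left less_irrefl times_divide_eq_right)
  also have "\<dots> \<longleftrightarrow> 0 \<le> a \<and> a < 1 - g \<and> 0 \<le> b \<and> b < 1 - g"
    using g1 by (simp add: L_point zero_le_divide_iff field_simps)
  finally show ?thesis .
qed

lemma T_Z_point: "point a b \<in> T ` Z \<longleftrightarrow> 0 \<le> a \<and> a < 1 \<and> g * a < b \<and> b < 1"
proof -
  have "point a b \<in> T ` Z \<longleftrightarrow> (\<exists>z\<in>Z. point a b = (z - 1) / zeta)"
    unfolding image_iff by (rule bex_cong) (auto simp: T_def Z_def)
  also have "\<dots> \<longleftrightarrow> 1 + zeta * point a b \<in> Z"
    by (auto simp: field_simps)
  also have "1 + zeta * point a b = point (1 + g * a - b) a"
    by (simp add: point_mult_zeta point_1 point_add)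
  also have "\<dots> \<in> Z \<longleftrightarrow> 0 \<le> a \<and> a < 1 \<and> g * a < b \<and> b < 1"
    using g_pos by (auto simp: Z_point) (smt (verit) mult_nonneg_nonneg)
  finally show ?thesis .
qed

lemma T_Delta: "point a b \<in> Delta \<Longrightarrow> T (point a b) = point b (g * b - a)"
  and T_not_Delta: "point a b \<notin> Delta \<Longrightarrow> T (point a b) = point b (g * b - a + 1)"
proof -
  show "point a b \<in> Delta \<Longrightarrow> T (point a b) = point b (g * b - a)"
    by (simp add: T_def point_div_zeta)
  have "(point a b - 1) / zeta = point b (g * b - a + 1)"
    unfolding point_1 point_diff point_div_zeta by simp
  then show "point a b \<notin> Delta \<Longrightarrow> T (point a b) = point b (g * b - a + 1)"
    by (simp add: T_def)
qed

section \<open>The four contractions\<close>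

definition branch :: "nat \<Rightarrow> complex \<Rightarrow> complex" where
  "branch m y = zeta ^ m / (of_real omega)\<^sup>2 * y + d m"

text \<open>The rotations, in coordinates: multiplication by \<open>\<zeta>\<close> is iterated and \<open>g * g\<close> is reduced.\<close>

lemma branch_point:
  "branch 0 (point a b) = point ((1 - g) * a) ((1 - g) * b)"
  "branch 2 (point a b) = point (g - (1 - g) * g * (a + b)) (1 + (1 - g) * (g * a - b))"
  "branch 3 (point a b) = point ((1 - g) * (1 + g * b - a)) (g - (1 - g) * g * (a + b))"
  "branch 5 (point a b) = point ((1 - g) * a) ((1 - g) * b + g)"
proof -
  have b: "branch m (point a b) = zeta ^ m * point ((1 - g) * a) ((1 - g) * b) + d m" for m
    by (simp add: branch_def flip: point_div_omega2)
  have og: "of_real omega = inverse (of_real g :: complex)"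
    by (simp add: g_def)
  have d2: "d 2 = point g 1" by (simp add: d_def zeta_eq)
  have d3: "d 3 = point (1 - g) g"
  proof -
    have "d 3 = of_real g * zeta" by (simp add: d_def og field_simps)
    then show ?thesis by (simp add: zeta_eq point_scale g_square)
  qed
  have d5: "d 5 = point 0 g"
    by (simp add: d_def og point_def field_simps)
  have d0: "d 0 = point 0 0" by (simp add: d_def point_def)
  have z2: "zeta ^ 2 * point u v = zeta * (zeta * point u v)"
    and z3: "zeta ^ 3 * point u v = zeta * (zeta * (zeta * point u v))" for u v
    by (simp_all add: power_numeral_reduce mult.assoc)
  show "branch 0 (point a b) = point ((1 - g) * a) ((1 - g) * b)"
    by (simp add: b d0 point_add)
  show "branch 5 (point a b) = point ((1 - g) * a) ((1 - g) * b + g)"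
    by (simp add: b d5 point_add zeta_power5)
  show "branch 2 (point a b) = point (g - (1 - g) * g * (a + b)) (1 + (1 - g) * (g * a - b))"
    unfolding b d2 z2 point_mult_zeta point_add
    by (simp add: algebra_simps g_square g_square_left)
  show "branch 3 (point a b) = point ((1 - g) * (1 + g * b - a)) (g - (1 - g) * g * (a + b))"
    unfolding b d3 z3 point_mult_zeta point_add
    by (simp add: algebra_simps g_square g_square_left)
qed

lemma norm_branch_diff: "norm (branch m x - branch m y) = (1 - g) * norm (x - y)"
proof -
  have "branch m x - branch m y = zeta ^ m / (of_real omega)\<^sup>2 * (x - y)"
    by (simp add: branch_def right_diff_distrib)
  also have "norm \<dots> = inverse (omega\<^sup>2) * norm (x - y)"
    using omega_pos by (simp add: norm_mult norm_divide norm_power divide_inverse norm_inverse)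
  finally show ?thesis by (simp add: omega_inverse)
qed

lemma dist_branch: "dist (branch m x) (branch m y) = (1 - g) * dist x y"
  by (simp add: dist_norm norm_branch_diff)

text \<open>The inverse of a branch, in the form in which the self-similar measure is defined.\<close>

definition unbranch :: "nat \<Rightarrow> complex \<Rightarrow> complex" where
  "unbranch m x = (of_real omega)\<^sup>2 / zeta ^ m * (x - d m)"

lemma unbranch_branch [simp]: "unbranch m (branch m y) = y"
  and branch_unbranch [simp]: "branch m (unbranch m y) = y"
  using omega_pos by (simp_all add: unbranch_def branch_def)

lemma inj_branch: "branch m x = branch m y \<longleftrightarrow> x = y"
  by (metis unbranch_branch)

lemma continuous_branch: "continuous_on A (branch m)"
  unfolding branch_def[abs_def] by (intro continuous_intros)

lemma continuous_unbranch: "continuous_on A (unbranch m)"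
  unfolding unbranch_def[abs_def] by (auto intro!: continuous_intros)

lemma measurable_branch [measurable]: "branch m \<in> borel_measurable borel"
  and measurable_unbranch [measurable]: "unbranch m \<in> borel_measurable borel"
  by (auto intro: borel_measurable_continuous_onI continuous_branch continuous_unbranch)

text \<open>The order in which the first return map visits the branches. Indices of 3 and more are
  sent to \<open>0\<close>, so that a search for the least index never leaves the digits.\<close>

definition expo :: "nat \<Rightarrow> nat" where
  "expo i = (if i = 0 then 5 else if i = 1 then 3 else if i = 2 then 2 else 0)"

lemma expo_cases [consumes 1]: "i < 4 \<Longrightarrow> (i = 0 \<Longrightarrow> expo i = 5 \<Longrightarrow> P) \<Longrightarrow> (i = 1 \<Longrightarrow> expo i = 3 \<Longrightarrow> P)
   \<Longrightarrow> (i = 2 \<Longrightarrow> expo i = 2 \<Longrightarrow> P) \<Longrightarrow> (i = 3 \<Longrightarrow> expo i = 0 \<Longrightarrow> P) \<Longrightarrow> P"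
  unfolding expo_def by (cases "i = 0 \<or> i = 1 \<or> i = 2 \<or> i = 3") auto

lemma expo_simps [simp]: "expo 0 = 5" "expo (Suc 0) = 3" "expo 2 = 2" "expo 3 = 0"
  by (simp_all add: expo_def)

lemma expo_image: "expo ` {..<4} = {0, 2, 3, 5}" "inj_on expo {..<4}"
proof -
  have "{..<4::nat} = {0, 1, 2, 3}" by auto
  then show "expo ` {..<4} = {0, 2, 3, 5}" "inj_on expo {..<4}"
    by (auto simp: expo_def)
qed

section \<open>An invariant polygon\<close>

text \<open>The disjunction makes the polygon non-convex. It cannot be dropped: in the convex polygon given by
  the other inequalities, branch \<open>3\<close> would map some points into \<open>L'\<close>, where they are mixed up with
  the image of branch \<open>0\<close>.\<close>

definition hull_region :: "complex set" where
  "hull_region = {x. 0 \<le> coord1 x \<and> g * coord1 x \<le> coord2 x \<and> coord2 x \<le> 1 \<and>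
      (coord1 x \<le> g * coord2 x \<or> coord1 x + coord2 x \<le> 1)}"

text \<open>The polygon without the edges on \<open>a = 0\<close>, \<open>b = g a\<close> and \<open>b = 1\<close>. On the two
  other edges the first return map and the hitting times behave as in the interior.\<close>

definition region :: "complex set" where
  "region = {x. 0 < coord1 x \<and> g * coord1 x < coord2 x \<and> coord2 x < 1 \<and>
      (coord1 x \<le> g * coord2 x \<or> coord1 x + coord2 x \<le> 1)}"

lemma closed_hull_region: "closed hull_region"
  unfolding hull_region_def
  by (intro closed_Collect_conj closed_Collect_disj closed_Collect_le continuous_intros
      continuous_coord)

lemma region_borel [measurable]: "region \<in> sets borel"
  unfolding region_def by measurable

lemma region_subset_hull: "region \<subseteq> hull_region"
  by (auto simp: region_def hull_region_def)

lemma zero_in_hull: "0 \<in> hull_region"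
  by (simp add: hull_region_def point_0)

lemma hull_point: "point a b \<in> hull_region \<longleftrightarrow>
    0 \<le> a \<and> g * a \<le> b \<and> b \<le> 1 \<and> (a \<le> g * b \<or> a + b \<le> 1)"
  and region_point: "point a b \<in> region \<longleftrightarrow>
    0 < a \<and> g * a < b \<and> b < 1 \<and> (a \<le> g * b \<or> a + b \<le> 1)"
  by (simp_all add: hull_region_def region_def)


lemmas g_simps = algebra_simps g_square g_square_left

text \<open>Reducing modulo \<open>g * g = 1 - g\<close> makes everything linear in \<open>a\<close>, \<open>b\<close>, \<open>g\<close>, \<open>g * a\<close> and
  \<open>g * b\<close>. The inclusions of polygons below then reduce to linear arithmetic, once the inequalities
  for the polygon are also multiplied by the positive numbers \<open>g\<close>, \<open>1 - g\<close> and \<open>2 * g - 1\<close>.\<close>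

lemma branch_linear:
  "branch 0 (point a b) = point (a - g * a) (b - g * b)"
  "branch 2 (point a b) = point (g + a + b - 2 * (g * a) - 2 * (g * b)) (1 - a - b + 2 * (g * a) + g * b)"
  "branch 3 (point a b) = point (1 - g - a - b + g * a + 2 * (g * b)) (g + a + b - 2 * (g * a) - 2 * (g * b))"
  "branch 5 (point a b) = point (a - g * a) (b - g * b + g)"
  by (simp_all add: branch_point g_simps)

lemma g_mult_linear:
  "g * (a - g * a) = 2 * (g * a) - a"
  "g * (b - g * b + g) = 2 * (g * b) - b + 1 - g"
  "g * (g + a + b - 2 * (g * a) - 2 * (g * b)) = 1 - g - 2 * a - 2 * b + 3 * (g * a) + 3 * (g * b)"
  "g * (1 - a - b + 2 * (g * a) + g * b) = g + 2 * a + b - 3 * (g * a) - 2 * (g * b)"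
  "g * (1 - g - a - b + g * a + 2 * (g * b)) = 2 * g - 1 + a + 2 * b - 2 * (g * a) - 3 * (g * b)"
  by (simp_all add: g_simps)

lemma g_mult_nonneg:
  assumes "0 \<le> u" shows "0 \<le> g * u" "0 \<le> u - g * u" "0 \<le> 2 * (g * u) - u"
proof -
  have "0 \<le> (1 - g) * u" "0 \<le> (2 * g - 1) * u" using assms g_bounds by simp_all
  then show "0 \<le> g * u" "0 \<le> u - g * u" "0 \<le> 2 * (g * u) - u"
    using assms g_pos by (simp_all add: algebra_simps)
qed

lemma g_mult_pos:
  assumes "0 < u" shows "0 < g * u" "0 < u - g * u" "0 < 2 * (g * u) - u"
proof -
  have "0 < (1 - g) * u" "0 < (2 * g - 1) * u" using assms g_bounds by simp_all
  then show "0 < g * u" "0 < u - g * u" "0 < 2 * (g * u) - u"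
    using assms g_pos by (simp_all add: algebra_simps)
qed

lemma g_mult_expand:
  "g * (b - g * a) = g * b - a + g * a" "g * (1 - u) = g - g * u" "g * (g * b - a) = b - g * b - g * a"
  "g * (1 - a - b) = g - g * a - g * b"
  by (simp_all add: g_simps)

lemma hull_linear:
  assumes "point a b \<in> hull_region"
  shows "0 \<le> a" "a \<le> 1" "0 \<le> b" "b \<le> 1" "g * a \<le> b"
    "0 \<le> g * b - a \<and> 0 \<le> b - g * b - g * a \<and> 0 \<le> 2 * (g * b) - b - a + g * a \<or>
     0 \<le> 1 - a - b \<and> 0 \<le> g - g * a - g * b \<and> 0 \<le> 1 - g - a - b + g * a + g * b \<and>
       0 \<le> 2 * g - 1 + a + b - 2 * (g * a) - 2 * (g * b)"
proof -
  have h: "0 \<le> a" "g * a \<le> b" "b \<le> 1" and disj: "0 \<le> g * b - a \<or> 0 \<le> 1 - a - b"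
    using assms by (auto simp: hull_point)
  show b: "0 \<le> b" using h g_mult_nonneg(1)[OF h(1)] by linarith
  show "a \<le> 1" using disj h b g_mult_nonneg(2)[OF b] by linarith
  show "0 \<le> a" "b \<le> 1" "g * a \<le> b" by fact+
  show "0 \<le> g * b - a \<and> 0 \<le> b - g * b - g * a \<and> 0 \<le> 2 * (g * b) - b - a + g * a \<or>
     0 \<le> 1 - a - b \<and> 0 \<le> g - g * a - g * b \<and> 0 \<le> 1 - g - a - b + g * a + g * b \<and>
       0 \<le> 2 * g - 1 + a + b - 2 * (g * a) - 2 * (g * b)"
    using disj
  proof
    assume "0 \<le> g * b - a"
    from g_mult_nonneg[OF this, unfolded g_mult_expand] this show ?thesis by (intro disjI1 conjI) linarith+
  next
    assume "0 \<le> 1 - a - b"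
    note u = this g_mult_nonneg[OF this, unfolded g_mult_expand]
    show ?thesis using u by (intro disjI2 conjI; simp add: algebra_simps)
  qed
qed

lemma region_strict:
  assumes "point a b \<in> region" shows "0 < a" "0 < b" "b < 1" "g * a < b" "a < 1"
proof -
  have h: "0 < a" "g * a < b" "b < 1" and disj: "0 \<le> g * b - a \<or> 0 \<le> 1 - a - b"
    using assms by (auto simp: region_point)
  show b: "0 < b" using h g_mult_pos(1)[OF h(1)] by linarith
  show "a < 1" using disj h b g_mult_pos(2)[OF b] by linarith
  show "0 < a" "b < 1" "g * a < b" by fact+
qed

lemma branch_hull:
  assumes "i < 4" "x \<in> hull_region" shows "branch (expo i) x \<in> hull_region"
proof -
  obtain a b where xab: "x = point a b" by (rule obtain_point)
  note h = hull_linear[OF assms(2)[unfolded xab]]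
  have h': "0 \<le> b - g * a" "0 \<le> 1 - b" "0 \<le> 1 - a" using h by auto
  note f = h g_bounds g_mult_nonneg[OF h(1)] g_mult_nonneg[OF h(3)]
    g_mult_nonneg[OF h'(1), unfolded g_mult_expand] g_mult_nonneg[OF h'(2), unfolded g_mult_expand]
    g_mult_nonneg[OF h'(3), unfolded g_mult_expand]
  show ?thesis
    using assms(1)
  proof (cases rule: expo_cases)
    case 1
    then show ?thesis unfolding xab \<open>expo i = 5\<close> branch_linear hull_point g_mult_linear
      using f by (intro conjI disjI1) linarith+
  next
    case 2
    then show ?thesis unfolding xab \<open>expo i = 3\<close> branch_linear hull_point g_mult_linear
      using f by (intro conjI disjI2) linarith+
  next
    case 3
    then show ?thesis unfolding xab \<open>expo i = 2\<close> branch_linear hull_point g_mult_linear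
      using f by (intro conjI disjI1) linarith+
  next
    case 4
    then show ?thesis unfolding xab \<open>expo i = 0\<close> branch_linear hull_point g_mult_linear
      using f by (intro conjI disjI2) linarith+
  qed
qed

lemma hull_diff_region:
  "point a b \<in> hull_region \<Longrightarrow> 0 < a \<Longrightarrow> g * a < b \<Longrightarrow> b < 1 \<Longrightarrow> point a b \<in> region"
  by (simp add: hull_point region_point)

lemma branch_region:
  assumes "i < 4" "x \<in> region" shows "branch (expo i) x \<in> region"
proof -
  have hull: "branch (expo i) x \<in> hull_region"
    using assms region_subset_hull branch_hull by blast
  obtain a b where xab: "x = point a b" by (rule obtain_point)
  have "point a b \<in> hull_region" using assms(2) region_subset_hull xab by blast
  note H = hull_linear[OF this]
  note h = region_strict[OF assms(2)[unfolded xab]]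
  have h': "0 < b - g * a" "0 < 1 - b" "0 < 1 - a" using h by auto
  note f = h g_bounds H(6) g_mult_pos[OF h(1)] g_mult_pos[OF h(2)]
    g_mult_pos[OF h'(1), unfolded g_mult_expand] g_mult_pos[OF h'(2), unfolded g_mult_expand]
    g_mult_pos[OF h'(3), unfolded g_mult_expand]
  show ?thesis
    using assms(1)
  proof (cases rule: expo_cases)
    case 1
    show ?thesis using hull unfolding xab \<open>expo i = 5\<close> branch_linear
      by (rule hull_diff_region; (unfold g_mult_linear)?; use f in linarith)
  next
    case 2
    show ?thesis using hull unfolding xab \<open>expo i = 3\<close> branch_linear
      by (rule hull_diff_region; (unfold g_mult_linear)?; use f in linarith)
  next
    case 3
    show ?thesis using hull unfolding xab \<open>expo i = 2\<close> branch_linear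
      by (rule hull_diff_region; (unfold g_mult_linear)?; use f in linarith)
  next
    case 4
    show ?thesis using hull unfolding xab \<open>expo i = 0\<close> branch_linear
      by (rule hull_diff_region; (unfold g_mult_linear)?; use f in linarith)
  qed
qed

text \<open>The image of the polygon under branch \<open>3\<close> touches the deleted edges only in points that come from
  the edge \<open>b = 1\<close>, and after the first application of the branch \<open>b\<close> is less than 1.\<close>

lemma branch_hull_interior:
  assumes "x \<in> hull_region" shows "branch 3 (branch 3 x) \<in> region"
proof -
  have hull: "branch 3 x \<in> hull_region" "branch 3 (branch 3 x) \<in> hull_region"
    using branch_hull[of 1] assms by simp_all
  have less: "coord2 (branch 3 x) < 1"
  proof -
    obtain a b where xab: "x = point a b" by (rule obtain_point)
    note h = hull_linear[OF assms[unfolded xab]]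
    show ?thesis
      unfolding xab branch_linear coord_point using g_mult_nonneg[OF h(1)] g_mult_nonneg[OF h(3)] g_bounds
      by linarith
  qed
  obtain a b where xab: "branch 3 x = point a b" by (rule obtain_point)
  have "0 < 1 - b" using less by (simp add: xab)
  note h = hull_linear[OF hull(1)[unfolded xab]] g_mult_pos[OF this, unfolded g_mult_expand]
  note f = h g_bounds g_mult_nonneg[OF h(1)] g_mult_nonneg[OF h(3)]
  show ?thesis using hull(2) unfolding xab branch_linear
    by (rule hull_diff_region; (unfold g_mult_linear)?; use f in linarith)
qed

section \<open>First return and first hitting maps on the region\<close>

lemma first_return_Some:
  assumes "x \<in> A" "(f ^^ n) x \<in> A" "n > 0" "\<And>k. 0 < k \<Longrightarrow> k < n \<Longrightarrow> (f ^^ k) x \<notin> A"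
  shows "first_return f A x = Some ((f ^^ n) x)"
proof -
  have "(LEAST n. n > 0 \<and> (f ^^ n) x \<in> A) = n"
    using assms by (intro Least_equality) (auto simp: not_less[symmetric])
  then show ?thesis using assms by (auto simp: first_return_def)
qed

text \<open>The first return map as a total function: two steps of \<open>T\<close> from \<open>Delta\<close>, one step otherwise.\<close>

definition return_map :: "complex \<Rightarrow> complex" where
  "return_map x = (if x \<in> Delta then T (T x) else T x)"

lemma region_in_L: assumes "x \<in> region" shows "x \<in> L" "x \<in> T ` Z"
proof -
  obtain a b where xab: "x = point a b" by (rule obtain_point)
  show "x \<in> L" "x \<in> T ` Z"
    using region_strict[of a b] assms by (auto simp: xab L_point T_Z_point)
qed

text \<open>Within the region, from \<open>Delta\<close> the map \<open>T\<close> leads out of \<open>T ` Z\<close> but into \<open>Z\<close>, so the return takes exactly two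
  steps.\<close>

lemma region_T_Delta:
  assumes "x \<in> region" "x \<in> Delta" shows "T x \<in> Z" "T x \<notin> T ` Z"
proof -
  obtain a b where xab: "x = point a b" by (rule obtain_point)
  have h: "0 < a" "0 < b" "b < 1" "g * a < b" "a < 1" "0 \<le> g * b - a"
    using assms region_strict[of a b] by (auto simp: xab Delta_point)
  have "point b (g * b - a) \<in> Z"
    unfolding Z_point g_mult_expand using h g_mult_pos[OF h(1)] g_mult_pos[OF h(2)]
    by (intro conjI) linarith+
  moreover have "point b (g * b - a) \<notin> T ` Z"
    unfolding T_Z_point using h by auto
  ultimately show "T x \<in> Z" "T x \<notin> T ` Z"
    using T_Delta[of a b] assms(2) by (simp_all add: xab)
qed

lemma T_tilde_region:
  assumes "x \<in> region" shows "T_tilde x = Some (return_map x)"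
proof (cases "x \<in> Delta")
  case True
  note D = region_T_Delta[OF assms True]
  have "first_return T (T ` Z) x = Some ((T ^^ 2) x)"
  proof (rule first_return_Some)
    show "(T ^^ k) x \<notin> T ` Z" if "0 < k" "k < 2" for k
    proof -
      have "k = 1" using that by simp
      then show ?thesis using D by simp
    qed
  qed (use D region_in_L[OF assms] in \<open>auto simp: numeral_2_eq_2\<close>)
  then show ?thesis using True by (simp add: T_tilde_def return_map_def numeral_2_eq_2)
next
  case False
  then have "x \<in> Z" using region_in_L[OF assms] by (simp add: Z_def)
  have "first_return T (T ` Z) x = Some ((T ^^ 1) x)"
    by (rule first_return_Some) (use \<open>x \<in> Z\<close> region_in_L[OF assms] in auto)
  then show ?thesis using False by (simp add: T_tilde_def return_map_def)
qed

lemma return_map_region: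
  assumes "x \<in> region"
  shows "return_map x = (if x \<in> Delta then (x / zeta - 1) / zeta else (x - 1) / zeta)"
  using region_T_Delta[OF assms] by (auto simp: return_map_def T_def Z_def)

text \<open>Which of the two rules of \<open>T\<close> applies is constant on the images of three branches; on the image of
  branch \<open>0\<close>, a mere scaling, it is the same as for the point itself because the line that bounds
  \<open>Delta\<close> passes through 0.\<close>

lemma Delta_branch:
  assumes "x \<in> region"
  shows "branch 5 x \<in> Delta" "branch 3 x \<in> Z" "branch 2 x \<in> Delta" "branch 0 x \<in> Delta \<longleftrightarrow> x \<in> Delta"
proof -
  obtain a b where xab: "x = point a b" by (rule obtain_point)
  have "point a b \<in> hull_region" using assms(1) region_subset_hull xab by blast
  note H = hull_linear[OF this]
  note h = region_strict[OF assms(1)[unfolded xab]]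
  have h': "0 < b - g * a" "0 < 1 - b" "0 < 1 - a" using h by auto
  note f = h g_bounds H(6) g_mult_pos[OF h(1)] g_mult_pos[OF h(2)]
    g_mult_pos[OF h'(1), unfolded g_mult_expand] g_mult_pos[OF h'(2), unfolded g_mult_expand]
    g_mult_pos[OF h'(3), unfolded g_mult_expand]
  have L: "point a b \<in> L" "branch 5 (point a b) \<in> L" "branch 3 (point a b) \<in> L"
      "branch 2 (point a b) \<in> L" "branch 0 (point a b) \<in> L"
    using region_in_L(1)[OF branch_region[OF _ assms], of 0] region_in_L(1)[OF branch_region[OF _ assms], of 1]
      region_in_L(1)[OF branch_region[OF _ assms], of 2] region_in_L(1)[OF branch_region[OF _ assms], of 3]
      region_in_L(1)[OF assms]
    by (auto simp: xab)
  show "branch 5 x \<in> Delta" "branch 3 x \<in> Z" "branch 2 x \<in> Delta"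
    using L unfolding xab branch_linear L_point Delta_point Z_point g_mult_linear
    by (intro conjI; use f in linarith)+
  have "(1 - g) * a \<le> g * ((1 - g) * b) \<longleftrightarrow> a \<le> g * b"
    using g_bounds by (subst mult.left_commute) simp
  then show "branch 0 x \<in> Delta \<longleftrightarrow> x \<in> Delta"
    using L by (simp add: xab branch_point Delta_point L_point)
qed

text \<open>The odometer rule. The first three equations raise the digit, the last one carries.\<close>

lemma return_map_branch:
  assumes "x \<in> region"
  shows "return_map (branch 5 x) = branch 3 x" "return_map (branch 3 x) = branch 2 x"
    "return_map (branch 2 x) = branch 0 x" "return_map (branch 0 x) = branch 5 (return_map x)"
proof -
  obtain a b where xab: "x = point a b" by (rule obtain_point)
  note B = branch_region[OF _ assms]
  have R: "branch 5 x \<in> region" "branch 3 x \<in> region" "branch 2 x \<in> region" "branch 0 x \<in> region"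
    using B[of 0] B[of 1] B[of 2] B[of 3] by simp_all
  have Z: "branch 3 x \<notin> Delta" using Delta_branch(2)[OF assms] by (simp add: Z_def)
  show "return_map (branch 5 x) = branch 3 x"
    unfolding return_map_region[OF R(1)] using Delta_branch(1)[OF assms]
    by (simp add: xab branch_point point_div_zeta point_1 point_diff g_simps)
  show "return_map (branch 3 x) = branch 2 x"
    unfolding return_map_region[OF R(2)] using Z
    by (simp add: xab branch_point point_div_zeta point_1 point_diff g_simps)
  show "return_map (branch 2 x) = branch 0 x"
    unfolding return_map_region[OF R(3)] using Delta_branch(3)[OF assms]
    by (simp add: xab branch_point point_div_zeta point_1 point_diff g_simps)
  show "return_map (branch 0 x) = branch 5 (return_map x)"
    unfolding return_map_region[OF R(4)] return_map_region[OF assms] Delta_branch(4)[OF assms]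
    by (simp add: xab branch_point point_div_zeta point_1 point_diff g_simps)
qed

lemma U_Some:
  assumes "x \<in> L" "(T ^^ n) x \<in> L'" "\<And>k. k < n \<Longrightarrow> (T ^^ k) x \<notin> L'"
  shows "U x = Some ((T ^^ n) x)"
proof -
  have "(LEAST n. (T ^^ n) x \<in> L') = n"
    using assms by (intro Least_equality) (auto simp: not_less[symmetric])
  then show ?thesis using assms by (auto simp: U_def)
qed

text \<open>The branch \<open>m\<close> is the \<open>m\<close>-th inverse iterate of \<open>T\<close> on the scaled copy. The orbit of
  \<open>branch 5 x\<close> runs through \<open>branch 3 x\<close>, \<open>branch 2 x\<close> and \<open>branch 0 x\<close>, with one point in
  between after the first and one after the third of these; all of them but the last avoid \<open>L'\<close>.\<close>

lemma hitting_time: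
  assumes "x \<in> region" "i < 4"
  shows "(T ^^ expo i) (branch (expo i) x) = x / (of_real omega)\<^sup>2"
    "x / (of_real omega)\<^sup>2 \<in> L'"
    "k < expo i \<Longrightarrow> (T ^^ k) (branch (expo i) x) \<notin> L'"
proof -
  obtain a b where xab: "x = point a b" by (rule obtain_point)
  show x': "x / (of_real omega)\<^sup>2 \<in> L'" using region_in_L(1)[OF assms(1)] by (auto simp: L'_def)
  have "point a b \<in> hull_region" using assms(1) region_subset_hull xab by blast
  note H = hull_linear[OF this]
  note h = region_strict[OF assms(1)[unfolded xab]]
  have h': "0 < b - g * a" "0 < 1 - b" "0 < 1 - a" using h by auto
  note f = h g_bounds H(6) g_mult_pos[OF h(1)] g_mult_pos[OF h(2)]
    g_mult_pos[OF h'(1), unfolded g_mult_expand] g_mult_pos[OF h'(2), unfolded g_mult_expand]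
    g_mult_pos[OF h'(3), unfolded g_mult_expand]
  note R = branch_region[OF _ assms(1)]
  note ret = return_map_branch[OF assms(1)] 
  have b0: "branch 0 x = x / (of_real omega)\<^sup>2" by (simp add: xab branch_point point_div_omega2)
  have T2: "T (T (branch 2 x)) = branch 0 x" "T (branch 3 x) = branch 2 x"
     "T (T (branch 5 x)) = branch 3 x"
    using ret Delta_branch[OF assms(1)] by (auto simp: return_map_def Z_def)
  have pow: "(T ^^ 2) z = T (T z)" "(T ^^ 3) z = T (T (T z))" "(T ^^ 4) z = T (T (T (T z)))"
    "(T ^^ 5) z = T (T (T (T (T z))))" for z
    by (simp_all add: eval_nat_numeral)
  have not2: "branch 2 x \<notin> L'" "T (branch 2 x) \<notin> L'"
  proof -
    have D: "branch 2 (point a b) \<in> Delta" using Delta_branch(3)[OF assms(1)] by (simp add: xab)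
    have "\<not> 1 - a - b + 2 * (g * a) + g * b < 1 - g" using f by linarith
    then show "branch 2 x \<notin> L'" "T (branch 2 x) \<notin> L'"
      using D unfolding xab branch_linear by (simp_all add: T_Delta L'_point)
  qed
  have not3: "branch 3 x \<notin> L'"
  proof -
    have "1 - g \<le> 1 - g - a - b + g * a + 2 * (g * b) \<or> 1 - g \<le> g + a + b - 2 * (g * a) - 2 * (g * b)"
      using H(6) by (elim disjE) linarith+
    then show ?thesis unfolding xab branch_linear L'_point by linarith
  qed
  have not5: "branch 5 x \<notin> L'" "T (branch 5 x) \<notin> L'"
  proof -
    have D: "branch 5 (point a b) \<in> Delta" using Delta_branch(1)[OF assms(1)] by (simp add: xab)
    have "\<not> b - g * b + g < 1 - g" using f by linarith
    then show "branch 5 x \<notin> L'" "T (branch 5 x) \<notin> L'"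
      using D unfolding xab branch_linear by (simp_all add: T_Delta L'_point)
  qed
  show "(T ^^ expo i) (branch (expo i) x) = x / (of_real omega)\<^sup>2"
    using assms(2) by (cases rule: expo_cases)
      (simp_all add: pow T2 b0)
  show "(T ^^ k) (branch (expo i) x) \<notin> L'" if "k < expo i"
    using assms(2)
  proof (cases rule: expo_cases)
    case 1
    then have "k \<in> {0, 1, 2, 3, 4}" using that by auto
    then show ?thesis using 1 not2 not3 not5 by (auto simp: T2 pow)
  next
    case 2
    then have "k \<in> {0, 1, 2}" using that by auto
    then show ?thesis using 2 not2 not3 not5 by (auto simp: T2 pow)
  next
    case 3
    then have "k \<in> {0, 1}" using that by auto
    then show ?thesis using 3 not2 not3 not5 by (auto simp: T2 pow)
  next
    case 4
    then show ?thesis using that by simp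
  qed
qed

lemma S_branch:
  assumes "x \<in> region" "i < 4"
  shows "S (branch (expo i) x) = Some x"
proof -
  have "branch (expo i) x \<in> L" using region_in_L(1) branch_region assms by blast
  from U_Some[OF this, of "expo i"] hitting_time[OF assms]
  have "U (branch (expo i) x) = Some (x / (of_real omega)\<^sup>2)" by simp
  then show ?thesis using omega_pos by (simp add: S_def)
qed

text \<open>Hitting times are determined by the point, hence tell the images of the branches apart.\<close>

lemma branch_disjoint:
  assumes "x \<in> region" "y \<in> region" "i < 4" "j < 4" "branch (expo i) x = branch (expo j) y"
  shows "i = j" "x = y"
proof -
  have "expo i = expo j"
    using hitting_time[OF assms(1,3)] hitting_time[OF assms(2,4)] assms(5)
    by (metis linorder_neqE_nat)
  then show "i = j" using expo_image(2) assms(3,4) by (auto dest: inj_onD)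
  show "x = y" using assms(5) \<open>i = j\<close> by (simp add: inj_branch)
qed

section \<open>The coding map\<close>

text \<open>A bounded orbit of errors that shrinks by a fixed factor at each step has no error at all. It is
  applied where two solutions of a contracting recursion have to coincide.\<close>

lemma contraction_zero:
  fixes e :: "nat \<Rightarrow> real"
  assumes step: "\<And>n. e n \<le> q * e (Suc n)" and bound: "\<And>n. e n \<le> K" and q: "0 \<le> q" "q < 1"
  shows "e 0 \<le> 0"
proof -
  have "e m \<le> q ^ n * K" for m n
  proof (induction n arbitrary: m)
    case (Suc n)
    have "e m \<le> q * e (Suc m)" by (rule step)
    also have "\<dots> \<le> q * (q ^ n * K)" using Suc q by (intro mult_left_mono) auto
    finally show ?case by (simp add: mult.assoc)
  qed (simp add: bound)
  moreover have "(\<lambda>n. q ^ n * K) \<longlonglongrightarrow> 0"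
    using q by (intro tendsto_mult_left_zero LIMSEQ_power_zero) simp
  ultimately show ?thesis by (intro LIMSEQ_le_const) auto
qed

primrec approx :: "nat \<Rightarrow> padic2 \<Rightarrow> complex" where
  "approx 0 x = 0"
| "approx (Suc n) x = branch (expo (digit x)) (approx n (rho x))"

definition coding :: "padic2 \<Rightarrow> complex" where
  "coding x = lim (\<lambda>n. approx n x)"

lemma norm_hull: "x \<in> hull_region \<Longrightarrow> norm x \<le> 2"
proof -
  assume x: "x \<in> hull_region"
  obtain a b where xab: "x = point a b" by (rule obtain_point)
  have "norm x \<le> norm (of_real a :: complex) + norm (of_real b * inverse zeta)"
    unfolding xab point_def by (rule norm_triangle_ineq4)
  also have "\<dots> = \<bar>a\<bar> + \<bar>b\<bar>" by (simp add: norm_mult norm_inverse)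
  finally show ?thesis using hull_linear[of a b] x xab by auto
qed

lemma approx_hull: "approx n x \<in> hull_region"
  by (induction n arbitrary: x) (auto simp: zero_in_hull intro: branch_hull digit_less)

lemma dist_approx: "dist (approx (n + k) x) (approx n x) \<le> 2 * (1 - g) ^ n"
proof (induction n arbitrary: x)
  case 0
  then show ?case using norm_hull[OF approx_hull] by simp
next
  case (Suc n)
  have "dist (approx (Suc n + k) x) (approx (Suc n) x) =
     (1 - g) * dist (approx (n + k) (rho x)) (approx n (rho x))"
    by (simp add: dist_branch)
  also have "\<dots> \<le> (1 - g) * (2 * (1 - g) ^ n)"
    using Suc g_bounds by (intro mult_left_mono) auto
  finally show ?case by simp
qed

lemma approx_tendsto: "(\<lambda>n. approx n x) \<longlonglongrightarrow> coding x"
proof -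
  have "Cauchy (\<lambda>n. approx n x)"
  proof (rule metric_CauchyI)
    fix e :: real assume "0 < e"
    have "(\<lambda>n. 2 * (1 - g) ^ n) \<longlonglongrightarrow> 0"
      using g_bounds by (intro tendsto_mult_right_zero LIMSEQ_power_zero) simp
    then have "\<forall>\<^sub>F n in sequentially. 2 * (1 - g) ^ n < e / 2"
      by (rule order_tendstoD(2)) (use \<open>0 < e\<close> in simp)
    then obtain N where N: "2 * (1 - g) ^ N < e / 2"
      unfolding eventually_sequentially by blast
    have "dist (approx m x) (approx n x) < e" if "m \<ge> N" "n \<ge> N" for m n
    proof -
      have "dist (approx m x) (approx N x) < e / 2" "dist (approx n x) (approx N x) < e / 2"
        using dist_approx[of N "m - N" x] dist_approx[of N "n - N" x] that N by simp_all
      then show ?thesis by (rule dist_triangle_half_l)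
    qed
    then show "\<exists>M. \<forall>m\<ge>M. \<forall>n\<ge>M. dist (approx m x) (approx n x) < e" by blast
  qed
  then show ?thesis
    unfolding coding_def using Cauchy_convergent convergent_LIMSEQ_iff by blast
qed

lemma coding_rec: "coding x = branch (expo (digit x)) (coding (rho x))"
proof (rule LIMSEQ_unique)
  have "continuous (at (coding (rho x))) (branch (expo (digit x)))"
    using continuous_branch[of UNIV] by (simp add: continuous_on_eq_continuous_at)
  then have "(\<lambda>n. approx (Suc n) x) \<longlonglongrightarrow> branch (expo (digit x)) (coding (rho x))"
    unfolding approx.simps by (rule continuous_at_sequentially[THEN iffD1, rule_format, unfolded o_def])
      (rule approx_tendsto)
  then show "(\<lambda>n. approx n x) \<longlonglongrightarrow> branch (expo (digit x)) (coding (rho x))"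
    by (rule LIMSEQ_imp_Suc)
qed (rule approx_tendsto)

lemma coding_hull: "coding x \<in> hull_region"
  by (rule closed_sequentially[OF closed_hull_region approx_hull approx_tendsto])

lemma measurable_coding [measurable]: "coding \<in> borel_measurable borel"
proof (rule borel_measurable_LIMSEQ_metric)
  show "(\<lambda>x. approx n x) \<in> borel_measurable borel" for n
  proof (induction n)
    case (Suc n)
    note [measurable] = Suc
    have "(\<lambda>x. branch (expo i) (approx n (rho x))) \<in> borel_measurable borel" for i
      by measurable
    from measurable_compose_countable[OF this measurable_digit] show ?case by simp
  qed simp
qed (rule approx_tendsto)

section \<open>The self-similar set\<close>

definition is_attractor :: "complex set \<Rightarrow> bool" where
  "is_attractor Y \<longleftrightarrow> Y \<noteq> {} \<and> compact Y \<and> Y = (\<Union>m\<in>{0, 2, 3, 5}. branch m ` Y)"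

text \<open>A point of \<open>A\<close> at the greatest distance from \<open>B\<close> is the image of a point of \<open>A\<close> whose distance from
  \<open>B\<close> is larger by the factor \<open>1 / (1 - g)\<close>, unless both distances are 0.\<close>

lemma attractor_subset:
  assumes A: "is_attractor A" and B: "is_attractor B" shows "A \<subseteq> B"
proof -
  have cB: "closed B" "B \<noteq> {}" using B by (auto simp: is_attractor_def compact_imp_closed)
  have "compact A" "A \<noteq> {}" using A by (auto simp: is_attractor_def)
  then have "\<exists>a\<in>A. \<forall>y\<in>A. infdist y B \<le> infdist a B"
    by (rule continuous_attains_sup) (intro continuous_on_infdist continuous_on_id)
  then obtain a where a: "a \<in> A" "\<And>y. y \<in> A \<Longrightarrow> infdist y B \<le> infdist a B"
    by blast
  obtain m a' where m: "m \<in> {0, 2, 3, 5}" "a' \<in> A" "a = branch m a'"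
    using A a(1) unfolding is_attractor_def by blast
  obtain b where b: "b \<in> B" "infdist a' B = dist a' b"
    using infdist_attains_inf[OF cB] by metis
  have "branch m b \<in> B" using B b(1) m(1) unfolding is_attractor_def by blast
  then have "infdist a B \<le> dist a (branch m b)" by (rule infdist_le)
  also have "\<dots> = (1 - g) * infdist a' B" by (simp add: m(3) dist_branch b(2))
  also have "\<dots> \<le> (1 - g) * infdist a B" using a(2)[OF m(2)] g_bounds by (intro mult_left_mono) auto
  finally have "g * infdist a B \<le> 0" by (simp add: algebra_simps)
  then have "infdist a B \<le> 0" using g_pos by (simp add: mult_le_0_iff)
  then have "infdist y B = 0" if "y \<in> A" for y
    using a(2)[OF that] infdist_nonneg[of y B] by linarith
  then show ?thesis using in_closed_iff_infdist_zero[OF cB] by blast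
qed

lemma coding_cons: "i < 4 \<Longrightarrow> branch (expo i) (coding y) = coding (of_nat i + 4 * y)"
  using rho_eqI[OF refl, of i y] by (subst (2) coding_rec) auto

text \<open>Prepending the four digits shows that the range of the coding map is the union of its images
  under the branches, and closures commute with finite unions and with the branches.\<close>

lemma attractor_coding: "is_attractor (closure (range coding))"
  unfolding is_attractor_def
proof (intro conjI)
  have "bounded (range coding)"
    unfolding bounded_iff using norm_hull[OF coding_hull] by auto
  then show c: "compact (closure (range coding))" by simp
  show "closure (range coding) = (\<Union>m\<in>{0, 2, 3, 5}. branch m ` closure (range coding))" (is "?K = ?U")
  proof
    have "compact ?U"
      by (intro compact_UN compact_continuous_image continuous_branch c) simp
    moreover have "coding x \<in> ?U" for x
    proof -
      have "expo (digit x) \<in> {0, 2, 3, 5}" using digit_less[of x] expo_image(1) by blast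
      then show ?thesis using coding_rec[of x] closure_subset[of "range coding"] by blast
    qed
    ultimately show "?K \<subseteq> ?U" by (intro closure_minimal compact_imp_closed) auto
    have "branch m ` closure (range coding) \<subseteq> closure (range coding)" if m: "m \<in> {0, 2, 3, 5}" for m
    proof (rule image_closure_subset)
      obtain i where i: "m = expo i" "i < 4" using m expo_image(1) by blast
      have "branch m (coding x) \<in> range coding" for x
        using coding_cons[OF i(2)] by (simp add: i(1))
      then show "branch m ` range coding \<subseteq> closure (range coding)"
        using closure_subset[of "range coding"] by blast
    qed (auto intro: continuous_branch)
    then show "?U \<subseteq> ?K" by blast
  qed
qed simp

lemma Y'_eq: "Y' = closure (range coding)"
proof -
  have "Y' = (THE Y. is_attractor Y)"
    unfolding Y'_def is_attractor_def branch_def[abs_def] by (rule refl)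
  also have "\<dots> = closure (range coding)"
    by (rule the_equality) (auto intro: attractor_coding dest: attractor_subset[OF _ attractor_coding]
        attractor_subset[OF attractor_coding])
  finally show ?thesis .
qed

lemma attractor_Y': "is_attractor Y'"
  by (simp add: Y'_eq attractor_coding)

lemma coding_Y': "coding x \<in> Y'"
  using closure_subset[of "range coding"] by (auto simp: Y'_eq)

lemma branch_Y': "m \<in> {0, 2, 3, 5} \<Longrightarrow> y \<in> Y' \<Longrightarrow> branch m y \<in> Y'"
  using attractor_Y' unfolding is_attractor_def by blast

lemma closed_Y': "closed Y'"
  by (simp add: Y'_eq)

lemma borel_Y' [measurable]: "Y' \<in> sets borel"
  using closed_Y' by (rule borel_closed)

abbreviation borel_Y :: "complex measure" where
  "borel_Y \<equiv> restrict_space borel Y'"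

lemma sets_borel_Y: "X \<in> sets borel_Y \<longleftrightarrow> X \<in> sets borel \<and> X \<subseteq> Y'"
  by (auto simp: sets_restrict_space_iff)

lemma space_borel_Y [simp]: "space borel_Y = Y'"
  by (simp add: space_restrict_space)

section \<open>The self-similar measure\<close>

definition is_self_similar :: "complex measure \<Rightarrow> bool" where
  "is_self_similar M \<longleftrightarrow> sets M = sets borel_Y \<and> prob_space M \<and>
     (\<forall>X\<in>sets M. measure M X = 1 / 4 * (\<Sum>m\<in>{0, 2, 3, 5}. measure M (unbranch m ` X \<inter> Y')))"

lemma unbranch_image: "unbranch m ` X = branch m -` X"
  by (auto simp: image_iff) (metis branch_unbranch unbranch_branch)+

lemma self_similar_space: "is_self_similar M \<Longrightarrow> space M = Y'"
  unfolding is_self_similar_def by (metis sets_eq_imp_space_eq space_borel_Y)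

text \<open>Unfolding self-similarity \<open>n\<close> times exhibits both measures as averages of \<open>4 ^ n\<close> probability
  measures, supported in the same pieces of diameter at most \<open>(1 - g) ^ n * D\<close>; a piece that meets \<open>C\<close>
  lies in the neighbourhood. The induction on \<open>n\<close> avoids speaking about pieces: it pulls \<open>C\<close> back along the
  branches, which enlarges the radius by \<open>1 / (1 - g)\<close>.\<close>

lemma self_similar_le_neighbourhood:
  assumes M: "is_self_similar M" and N: "is_self_similar N"
    and D: "\<And>x y. x \<in> Y' \<Longrightarrow> y \<in> Y' \<Longrightarrow> dist x y \<le> D"
    and C: "closed C" "C \<subseteq> Y'" "C \<noteq> {}"
  shows "measure M C \<le> measure N {y \<in> Y'. infdist y C \<le> (1 - g) ^ n * D}"
  using C
proof (induction n arbitrary: C)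
  case 0
  obtain c where c: "c \<in> C" using 0 by blast
  have "infdist y C \<le> D" if "y \<in> Y'" for y
    using infdist_le[OF c, of y] D[OF that, of c] c 0 by auto
  then have "{y \<in> Y'. infdist y C \<le> (1 - g) ^ 0 * D} = space N"
    by (auto simp: self_similar_space[OF N])
  then show ?case
    using M N by (simp add: is_self_similar_def prob_space.prob_space prob_space.prob_le_1)
next
  case (Suc n)
  define W where "W = {y \<in> Y'. infdist y C \<le> (1 - g) ^ Suc n * D}"
  have sN: "sets N = sets borel_Y" and "prob_space N"
    using N by (auto simp: is_self_similar_def)
  interpret N: prob_space N by fact
  have closed_nbhd: "closed {y \<in> Y'. infdist y E \<le> r}" for E r
    using closed_Int[OF closed_Y' closed_Collect_le[OF continuous_on_infdist[OF continuous_on_id] continuous_on_const[of _ r]], of E]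
    by (simp add: Int_def)
  have Ws: "W \<in> sets N" unfolding W_def
    by (subst sN, subst sets_borel_Y, intro conjI borel_closed closed_nbhd) auto
  have "measure M (unbranch m ` C \<inter> Y') \<le> measure N (unbranch m ` W \<inter> Y')" if m: "m \<in> {0, 2, 3, 5}" for m
  proof (cases "unbranch m ` C \<inter> Y' = {}")
    case False
    let ?C = "unbranch m ` C \<inter> Y'"
    have "closed (branch m -` C)"
      using Suc.prems(1) by (intro continuous_closed_vimage) (use continuous_branch[of UNIV m] in
          \<open>auto simp: continuous_on_eq_continuous_at\<close>)
    then have cl: "closed ?C" by (simp add: unbranch_image closed_Int closed_Y')
    from Suc.IH[OF this _ False]
    have "measure M ?C \<le> measure N {y \<in> Y'. infdist y ?C \<le> (1 - g) ^ n * D}" by simp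
    also have "\<dots> \<le> measure N (unbranch m ` W \<inter> Y')"
    proof (rule N.finite_measure_mono)
      have "branch m -` W \<inter> Y' \<in> sets borel"
        using measurable_sets[OF measurable_branch, of W] Ws sN by (auto simp: sets_borel_Y)
      then show "unbranch m ` W \<inter> Y' \<in> sets N"
        unfolding sN sets_borel_Y unbranch_image by auto
      show "{y \<in> Y'. infdist y ?C \<le> (1 - g) ^ n * D} \<subseteq> unbranch m ` W \<inter> Y'"
      proof safe
        fix y assume y: "y \<in> Y'" "infdist y ?C \<le> (1 - g) ^ n * D"
        obtain c where c: "c \<in> ?C" "infdist y ?C = dist y c"
          using infdist_attains_inf[OF cl False] by metis
        have "branch m c \<in> C" using c(1) by (auto simp: unbranch_image)
        then have "infdist (branch m y) C \<le> dist (branch m y) (branch m c)" by (rule infdist_le)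
        also have "\<dots> = (1 - g) * infdist y ?C" by (simp add: dist_branch c(2))
        also have "\<dots> \<le> (1 - g) * ((1 - g) ^ n * D)" using y g_bounds by (intro mult_left_mono) auto
        finally have "branch m y \<in> W" using branch_Y'[OF m y(1)] by (simp add: W_def mult.assoc)
        then show "y \<in> unbranch m ` W" by (simp add: unbranch_image)
      qed
    qed
    finally show ?thesis .
  qed simp
  then have "1 / 4 * (\<Sum>m\<in>{0, 2, 3, 5}. measure M (unbranch m ` C \<inter> Y'))
      \<le> 1 / 4 * (\<Sum>m\<in>{0, 2, 3, 5}. measure N (unbranch m ` W \<inter> Y'))"
    by (intro mult_left_mono sum_mono) auto
  moreover have "C \<in> sets M"
    using M Suc.prems by (auto simp: is_self_similar_def sets_borel_Y borel_closed)
  then have "measure M C = 1 / 4 * (\<Sum>m\<in>{0, 2, 3, 5}. measure M (unbranch m ` C \<inter> Y'))"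
    using M unfolding is_self_similar_def by blast
  moreover have "measure N W = 1 / 4 * (\<Sum>m\<in>{0, 2, 3, 5}. measure N (unbranch m ` W \<inter> Y'))"
    using N Ws unfolding is_self_similar_def by blast
  ultimately show ?case unfolding W_def[symmetric] by linarith
qed

lemma self_similar_le:
  assumes M: "is_self_similar M" and N: "is_self_similar N" and C: "closed C" "C \<subseteq> Y'"
  shows "measure M C \<le> measure N C"
proof (cases "C = {}")
  case False
  have "bounded Y'" using attractor_Y' by (auto simp: is_attractor_def compact_imp_bounded)
  then obtain D where D: "\<And>x y. x \<in> Y' \<Longrightarrow> y \<in> Y' \<Longrightarrow> dist x y \<le> D"
    unfolding bounded_two_points by blast
  have D0: "0 \<le> D" using D[of "coding 0" "coding 0"] coding_Y' by simp
  define W where "W n = {y \<in> Y'. infdist y C \<le> (1 - g) ^ n * D}" for n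
  interpret N: prob_space N using N by (simp add: is_self_similar_def)
  have sN: "sets N = sets borel_Y" using N by (auto simp: is_self_similar_def)
  have "closed (W n)" for n
    using closed_Int[OF closed_Y' closed_Collect_le[OF continuous_on_infdist[OF continuous_on_id] continuous_on_const], of C "(1 - g) ^ n * D"]
    by (simp add: Int_def W_def)
  then have Ws: "range W \<subseteq> sets N"
    unfolding sN by (auto simp: sets_borel_Y W_def[abs_def] borel_closed)
  have "(1 - g) ^ n * D \<le> (1 - g) ^ m * D" if "m \<le> n" for m n
    using that D0 g_bounds by (intro mult_right_mono power_decreasing) auto
  then have "decseq W"
    unfolding decseq_def W_def by (blast intro: order_trans)
  then have "(\<lambda>n. measure N (W n)) \<longlonglongrightarrow> measure N (\<Inter>n. W n)"
    by (rule N.finite_Lim_measure_decseq[OF Ws])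
  moreover have "(\<Inter>n. W n) = C"
  proof
    have lim: "(\<lambda>n. (1 - g) ^ n * D) \<longlonglongrightarrow> 0"
      using g_bounds by (intro tendsto_mult_left_zero LIMSEQ_power_zero) simp
    show "(\<Inter>n. W n) \<subseteq> C"
    proof
      fix y assume "y \<in> (\<Inter>n. W n)"
      then have "infdist y C \<le> 0"
        by (intro LIMSEQ_le_const[OF lim]) (auto simp: W_def)
      then show "y \<in> C"
        using in_closed_iff_infdist_zero[OF C(1) False] infdist_nonneg[of y C] by auto
    qed
    show "C \<subseteq> (\<Inter>n. W n)" using C(2) D0 g_bounds by (auto simp: W_def)
  qed
  moreover have "measure M C \<le> measure N (W n)" for n
    unfolding W_def by (rule self_similar_le_neighbourhood[OF M N D C False])
  ultimately show ?thesis by (intro LIMSEQ_le_const) auto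
qed simp

text \<open>By symmetry both measures agree on closed sets, and these generate the Borel sets.\<close>

lemma self_similar_unique:
  assumes M: "is_self_similar M" and N: "is_self_similar N" shows "M = N"
proof -
  have s: "sets M = sets borel_Y" "sets N = sets borel_Y" "prob_space M" "prob_space N"
    using M N by (auto simp: is_self_similar_def)
  interpret M: prob_space M by fact
  interpret N: prob_space N by fact
  note sp = self_similar_space[OF M] self_similar_space[OF N]
  have "(\<lambda>x. x) \<in> borel_Y \<rightarrow>\<^sub>M borel" by (intro measurable_restrict_space1) simp
  then have id: "(\<lambda>x. x) \<in> M \<rightarrow>\<^sub>M borel" "(\<lambda>x. x) \<in> N \<rightarrow>\<^sub>M borel"
    using s by (auto cong: measurable_cong_sets)
  have "distr M borel (\<lambda>x. x) = distr N borel (\<lambda>x. x)"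
  proof (rule measure_eqI_generator_eq[where E="Collect closed" and \<Omega>=UNIV and A="\<lambda>_. UNIV"])
    show "emeasure (distr M borel (\<lambda>x. x)) X = emeasure (distr N borel (\<lambda>x. x)) X"
      if X: "X \<in> Collect closed" for X
    proof -
      have c: "closed (X \<inter> Y')" using X closed_Y' by auto
      have "measure M (X \<inter> Y') = measure N (X \<inter> Y')"
        using self_similar_le[OF M N c] self_similar_le[OF N M c] by auto
      then show ?thesis
        using id X by (simp add: emeasure_distr borel_closed sp M.emeasure_eq_measure N.emeasure_eq_measure)
    qed
    show "emeasure (distr M borel (\<lambda>x. x)) UNIV \<noteq> \<infinity>"
      using id by (simp add: emeasure_distr)
  qed (auto simp: Int_stable_def borel_eq_closed)
  then have eq: "emeasure (distr M borel (\<lambda>x. x)) X = emeasure (distr N borel (\<lambda>x. x)) X" for X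
    by simp
  show ?thesis
  proof (rule measure_eqI)
    fix X assume "X \<in> sets M"
    then have "X \<in> sets borel" "X \<subseteq> Y'" using s by (auto simp: sets_borel_Y)
    then show "emeasure M X = emeasure N X"
      using eq[of X] id by (simp add: emeasure_distr sp Int_absorb2)
  qed (simp add: s)
qed

lemma measurable_coding_Y: "coding \<in> borel \<rightarrow>\<^sub>M borel_Y"
  by (intro measurable_restrict_space2) (auto simp: coding_Y')

lemma measurable_coding_haar: "coding \<in> padic2_haar \<rightarrow>\<^sub>M borel_Y"
  using measurable_coding_Y by (simp cong: measurable_cong_sets)

lemma measure_distr_coding:
  "X \<in> sets borel_Y \<Longrightarrow> measure (distr padic2_haar borel_Y coding) X = measure padic2_haar (coding -` X)"
  by (subst measure_distr[OF measurable_coding_haar]) auto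

text \<open>Splitting according to the lowest digit gives one summand for each branch.\<close>

lemma self_similar_coding: "is_self_similar (distr padic2_haar borel_Y coding)"
  unfolding is_self_similar_def
proof (intro conjI ballI)
  show "prob_space (distr padic2_haar borel_Y coding)"
    by (rule haar.prob_space_distr[OF measurable_coding_haar])
  fix X assume "X \<in> sets (distr padic2_haar borel_Y coding)"
  then have X: "X \<in> sets borel_Y" by simp
  then have [measurable]: "X \<in> sets borel" by (simp add: sets_borel_Y)
  have V: "coding -` X \<in> sets borel"
    using measurable_sets[OF measurable_coding, of X] by simp
  define p where "p m = measure (distr padic2_haar borel_Y coding) (unbranch m ` X \<inter> Y')" for m
  have "measure padic2_haar {x. digit x = i \<and> x \<in> coding -` X} = p (expo i) / 4" if i: "i < 4" for i
  proof -
    let ?E = "coding -` (branch (expo i) -` X \<inter> Y')"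
    have b: "branch (expo i) -` X \<inter> Y' \<in> sets borel"
      using measurable_sets[OF measurable_branch, of X] by simp
    then have E: "?E \<in> sets borel" using measurable_sets[OF measurable_coding b] by simp
    have "coding x \<in> X \<longleftrightarrow> rho x \<in> ?E" if "digit x = i" for x
      using coding_rec[of x] coding_Y'[of "rho x"] that by simp
    then have "{x. digit x = i \<and> x \<in> coding -` X} = {x. digit x = i \<and> rho x \<in> ?E}"
      by auto
    then have "measure padic2_haar {x. digit x = i \<and> x \<in> coding -` X} = measure padic2_haar ?E / 4"
      using haar_digit_rho[OF i E] by simp
    also have "measure padic2_haar ?E = p (expo i)"
      unfolding p_def unbranch_image using b by (subst measure_distr_coding) (auto simp: sets_borel_Y)
    finally show ?thesis .
  qed
  then have "measure padic2_haar (coding -` X) = (\<Sum>i<4. p (expo i) / 4)"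
    unfolding measure_sum_digit[OF V] by (intro sum.cong) auto
  also have "\<dots> = 1 / 4 * (\<Sum>m\<in>expo ` {..<4}. p m)"
    by (simp add: sum.reindex[OF expo_image(2)] sum_divide_distrib)
  finally show "measure (distr padic2_haar borel_Y coding) X =
     1 / 4 * (\<Sum>m\<in>{0, 2, 3, 5}. measure (distr padic2_haar borel_Y coding) (unbranch m ` X \<inter> Y'))"
    unfolding expo_image(1) p_def measure_distr_coding[OF X] .
qed simp

lemma nu_eq: "nu = distr padic2_haar borel_Y coding"
proof -
  have "nu = (THE M. is_self_similar M)"
    unfolding nu_def is_self_similar_def unbranch_def[abs_def] by (rule refl)
  also have "\<dots> = distr padic2_haar borel_Y coding"
    by (rule the_equality) (auto intro: self_similar_coding dest: self_similar_unique[OF _ self_similar_coding])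
  finally show ?thesis .
qed

lemma sets_nu [simp, measurable_cong]: "sets nu = sets borel_Y"
  by (simp add: nu_eq)

lemma space_nu [simp]: "space nu = Y'"
  by (simp add: nu_eq)

section \<open>Generic points and the carry rule\<close>

text \<open>Requiring all shifts to be coded into the region makes the set invariant under \<open>rho\<close>.\<close>

definition good :: "padic2 set" where
  "good = {x. \<forall>n. coding ((rho ^^ n) x) \<in> region}"

lemma coding_region_rho: "coding (rho x) \<in> region \<Longrightarrow> coding x \<in> region"
  using branch_region[OF digit_less[of x]] by (subst coding_rec)

lemma coding_region_word:
  assumes "digit x = 1" "digit (rho x) = 1" shows "coding x \<in> region"
  using branch_hull_interior[OF coding_hull[of "rho (rho x)"]] coding_rec[of x] coding_rec[of "rho x"] assms
  by simp

text \<open>A bad point has a bad shift, and a bad second shift preceded by the digits \<open>1, 1\<close> does not come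
  from a bad point. Hence the preimage of the bad set under the second shift, which has the same measure
  \<open>q\<close>, contains besides the bad set a disjoint set of measure \<open>q / 16\<close>.\<close>

lemma measure_bad: "measure padic2_haar {x. coding x \<notin> region} = 0"
proof -
  let ?E = "{x. coding x \<notin> region}"
  have E [measurable]: "?E \<in> sets borel" by measurable
  \<comment> \<open>the digit \<open>1\<close> belongs to branch \<open>3\<close>\<close>
  define W where "W = {x. digit x = 1 \<and> rho x \<in> {y. digit y = 1 \<and> rho y \<in> ?E}}"
  have rE: "rho -` ?E \<in> sets borel"
    using measurable_sets[OF measurable_rho E] by (simp only: space_borel Int_UNIV_right)
  have W [measurable]: "W \<in> sets borel" unfolding W_def by measurable
  have W': "measure padic2_haar W = measure padic2_haar ?E / 16"
    unfolding W_def by (subst haar_digit_rho, simp, measurable, subst haar_digit_rho) (simp_all add: E)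
  have "?E \<inter> W = {}" using coding_region_word by (auto simp: W_def)
  then have "measure padic2_haar ?E + measure padic2_haar W = measure padic2_haar (?E \<union> W)"
    using E W by (subst haar.finite_measure_Union) auto
  also have "\<dots> \<le> measure padic2_haar (rho -` (rho -` ?E))"
  proof (rule haar.finite_measure_mono)
    show "?E \<union> W \<subseteq> rho -` (rho -` ?E)" using coding_region_rho by (auto simp: W_def)
    show "rho -` (rho -` ?E) \<in> sets padic2_haar"
      using measurable_sets[OF measurable_rho rE] by (simp only: space_borel Int_UNIV_right sets_haar)
  qed
  also have "\<dots> = measure padic2_haar ?E"
    using haar_rho[OF rE] haar_rho[OF E] by (simp only:)
  finally show ?thesis using W' measure_nonneg[of padic2_haar ?E] by simp
qed

lemma measurable_good [measurable]: "good \<in> sets borel"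
proof -
  have "(\<lambda>x. coding ((rho ^^ n) x)) \<in> borel_measurable borel" for n
  proof (rule measurable_compose[OF _ measurable_coding])
    show "rho ^^ n \<in> borel \<rightarrow>\<^sub>M borel" by (induction n) (auto intro: measurable_comp)
  qed
  note [measurable] = this
  show ?thesis unfolding good_def by measurable
qed

lemma AE_good: "AE x in padic2_haar. x \<in> good"
proof -
  let ?E = "{x. coding x \<notin> region}"
  have E: "?E \<in> sets borel" by measurable
  have "AE x in padic2_haar. coding ((rho ^^ n) x) \<in> region" for n
  proof -
    have "(rho ^^ n) -` ?E \<in> sets borel \<and> measure padic2_haar ((rho ^^ n) -` ?E) = 0"
    proof (induction n)
      case (Suc n)
      define V where "V = (rho ^^ n) -` ?E"
      have V: "V \<in> sets borel" "measure padic2_haar V = 0" using Suc by (auto simp: V_def)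
      have "rho -` V \<in> sets borel" using measurable_sets[OF measurable_rho V(1)] by simp
      moreover have "(rho ^^ Suc n) -` ?E = rho -` V"
        by (auto simp: funpow_swap1 V_def)
      ultimately show ?case using haar_rho[OF V(1)] V(2) by (simp only:)
    qed (simp add: E measure_bad)
    then have "(rho ^^ n) -` ?E \<in> null_sets padic2_haar"
      by (auto simp: null_sets_def haar.emeasure_eq_measure)
    from AE_not_in[OF this] show ?thesis by simp
  qed
  then show ?thesis unfolding good_def by (simp add: AE_all_countable)
qed

lemma good_region: "x \<in> good \<Longrightarrow> coding x \<in> region"
  unfolding good_def by (metis (mono_tags) funpow_0 mem_Collect_eq)

lemma good_rho: "x \<in> good \<Longrightarrow> rho x \<in> good"
proof -
  assume "x \<in> good"
  then have "coding ((rho ^^ Suc n) x) \<in> region" for n unfolding good_def by blast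
  then show ?thesis unfolding good_def by (simp add: funpow_swap1)
qed

lemma good_funpow_rho: "x \<in> good \<Longrightarrow> (rho ^^ n) x \<in> good"
  by (induction n) (auto intro: good_rho)

text \<open>Otherwise the point would be coded by the fixed point 0 of branch \<open>0\<close>, a vertex of the polygon.\<close>

lemma good_ex_digit:
  assumes "x \<in> good" shows "\<exists>n. digit ((rho ^^ n) x) \<noteq> 3"
proof (rule ccontr)
  assume "\<not> ?thesis"
  then have three: "digit ((rho ^^ n) x) = 3" for n by blast
  have "norm (coding ((rho ^^ 0) x)) \<le> 0"
  proof (rule contraction_zero)
    show "norm (coding ((rho ^^ n) x)) \<le> (1 - g) * norm (coding ((rho ^^ Suc n) x))" for n
      using norm_branch_diff[of 0 "coding ((rho ^^ Suc n) x)" 0] coding_rec[of "(rho ^^ n) x"] three[of n]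
      by (simp add: branch_def d_def)
    show "norm (coding ((rho ^^ n) x)) \<le> 2" for n by (rule norm_hull[OF coding_hull])
  qed (use g_bounds in auto)
  then have "coding x = point 0 0" by (simp add: point_0)
  then show False using good_region[OF assms] by (simp add: region_point)
qed

lemma coding_add_one_no_carry:
  assumes "x \<in> good" "digit x \<noteq> 3"
  shows "coding (x + 1) \<in> region" "return_map (coding x) = coding (x + 1)"
proof -
  have d: "digit x < 3" using digit_less[of x] assms(2) by simp
  note R = good_region[OF good_rho[OF assms(1)]]
  have eq: "coding (x + 1) = branch (expo (Suc (digit x))) (coding (rho x))"
    using coding_rec[of "x + 1"] digit_add_one[OF d] by simp
  then show "coding (x + 1) \<in> region" using branch_region[OF _ R] d by simp
  consider "digit x = 0" | "digit x = 1" | "digit x = 2" using d by linarith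
  then show "return_map (coding x) = coding (x + 1)"
    unfolding eq coding_rec[of x] using return_map_branch(1-3)[OF R]
    by cases (simp_all add: numeral_2_eq_2[symmetric] numeral_3_eq_3[symmetric])
qed

text \<open>Carries are followed up to the first digit different from \<open>3\<close>.\<close>

lemma coding_add_one:
  assumes "x \<in> good" shows "coding (x + 1) \<in> region" "return_map (coding x) = coding (x + 1)"
proof -
  have *: "coding (x + 1) \<in> region \<and> return_map (coding x) = coding (x + 1)"
    if "x \<in> good" "digit ((rho ^^ n) x) \<noteq> 3" for n x
    using that
  proof (induction n arbitrary: x)
    case (Suc n)
    show ?case
    proof (cases "digit x = 3")
      case True
      have IH: "coding (rho x + 1) \<in> region" "return_map (coding (rho x)) = coding (rho x + 1)"
        using Suc.IH[of "rho x"] Suc.prems good_rho by (auto simp: funpow_swap1)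
      have eq: "coding (x + 1) = branch 5 (coding (rho x + 1))" "coding x = branch 0 (coding (rho x))"
        using coding_rec[of "x + 1"] coding_rec[of x] digit_carry[OF True] True by simp_all
      show ?thesis
        using branch_region[of 0, OF _ IH(1)] return_map_branch(4)[OF good_region[OF good_rho[OF Suc.prems(1)]]]
        unfolding eq by (simp add: IH(2))
    qed (use Suc.prems coding_add_one_no_carry in blast)
  qed (use coding_add_one_no_carry in auto)
  show "coding (x + 1) \<in> region" "return_map (coding x) = coding (x + 1)"
    using good_ex_digit[OF assms] *[OF assms] by blast+
qed

text \<open>Adding one changes a shift of \<open>x\<close> by at most a carry, so \<open>coding_add_one\<close> applies at each level.\<close>

lemma good_add_one:
  assumes "x \<in> good" shows "x + 1 \<in> good"
proof -
  have "coding ((rho ^^ n) (x + 1)) \<in> region" if "x \<in> good" for n x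
    using that
  proof (induction n arbitrary: x)
    case (Suc n)
    have "rho (x + 1) = rho x \<or> rho (x + 1) = rho x + 1"
    proof (cases "digit x = 3")
      case False
      then have "digit x < 3" using digit_less[of x] by simp
      then show ?thesis using digit_add_one by blast
    qed (use digit_carry in blast)
    then show ?case
      using Suc.IH[OF good_rho[OF Suc.prems]] good_region[OF good_funpow_rho[OF good_rho[OF Suc.prems]]]
      by (auto simp: funpow_swap1)
  qed (simp add: coding_add_one)
  then show ?thesis using assms unfolding good_def by blast
qed

section \<open>Decoding\<close>

text \<open>The least index is the only one below 4 for images of the region; as an explicit search it is Borel
  measurable on the whole plane.\<close>

definition address :: "complex \<Rightarrow> nat" where
  "address z = (LEAST i. unbranch (expo i) z \<in> region)"

definition expand :: "complex \<Rightarrow> complex" where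
  "expand z = unbranch (expo (address z)) z"

definition decode :: "complex \<Rightarrow> padic2" where
  "decode z = of_digits (\<lambda>n. address ((expand ^^ n) z))"

lemma address_branch:
  assumes "x \<in> region" "i < 4" shows "address (branch (expo i) x) = i"
proof -
  let ?z = "branch (expo i) x"
  have "unbranch (expo i) ?z \<in> region" using assms by simp
  then have "unbranch (expo (address ?z)) ?z \<in> region" "address ?z \<le> i"
    unfolding address_def by (rule LeastI, rule Least_le)
  then show ?thesis
    using branch_disjoint(1)[of "unbranch (expo (address ?z)) ?z" x "address ?z" i] assms by simp
qed

lemma address_coding:
  assumes "x \<in> good" shows "address (coding x) = digit x" "expand (coding x) = coding (rho x)"
proof -
  show a: "address (coding x) = digit x"
    using address_branch[OF good_region[OF good_rho[OF assms]] digit_less[of x]]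
    by (simp flip: coding_rec)
  show "expand (coding x) = coding (rho x)"
    unfolding expand_def a by (subst coding_rec) simp
qed

lemma decode_coding: "x \<in> good \<Longrightarrow> decode (coding x) = x"
proof -
  assume x: "x \<in> good"
  have "(expand ^^ n) (coding x) = coding ((rho ^^ n) x)" for n
    by (induction n) (simp_all add: address_coding(2) good_funpow_rho[OF x])
  then show ?thesis
    unfolding decode_def using address_coding(1)[OF good_funpow_rho[OF x]] of_digits_digits[of x]
    by simp
qed

text \<open>The image of \<open>good\<close> under the coding map, described without reference to that map so that
  its measurability is evident.\<close>

definition decodable :: "complex set" where
  "decodable = {z. \<forall>n. \<exists>i<4. unbranch (expo i) ((expand ^^ n) z) \<in> region}"

lemma measurable_address [measurable]: "address \<in> borel \<rightarrow>\<^sub>M count_space UNIV"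
  unfolding address_def by measurable

lemma measurable_expand [measurable]: "expand \<in> borel \<rightarrow>\<^sub>M borel"
  unfolding expand_def by (rule measurable_compose_countable[OF measurable_unbranch measurable_address])

lemma measurable_expand_pow [measurable]: "expand ^^ n \<in> borel \<rightarrow>\<^sub>M borel"
  by (induction n) (auto intro: measurable_comp)

lemma measurable_decode [measurable]: "decode \<in> borel \<rightarrow>\<^sub>M borel"
  unfolding decode_def by (rule measurable_of_digits) measurable

lemma borel_decodable [measurable]: "decodable \<in> sets borel"
  unfolding decodable_def by measurable

lemma decodable_unfold:
  assumes "z \<in> decodable"
  shows "address z < 4" "expand z \<in> region" "z = branch (expo (address z)) (expand z)"
    "expand z \<in> decodable"
proof -
  have "\<exists>i<4. unbranch (expo i) ((expand ^^ 0) z) \<in> region"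
    using assms unfolding decodable_def by blast
  then obtain i where i: "i < 4" "unbranch (expo i) z \<in> region" by auto
  show "address z < 4" using Least_le[of "\<lambda>i. unbranch (expo i) z \<in> region" i] i
    unfolding address_def by simp
  show "expand z \<in> region" using LeastI[of "\<lambda>i. unbranch (expo i) z \<in> region" i] i
    unfolding address_def expand_def by simp
  show "z = branch (expo (address z)) (expand z)" by (simp add: expand_def)
  have "\<exists>i<4. unbranch (expo i) ((expand ^^ Suc n) z) \<in> region" for n
    using assms unfolding decodable_def by blast
  then show "expand z \<in> decodable" unfolding decodable_def by (simp add: funpow_swap1)
qed

lemma decodable_funpow: "z \<in> decodable \<Longrightarrow> (expand ^^ n) z \<in> decodable"
  by (induction n) (auto intro: decodable_unfold)

lemma decode_unfold:
  assumes "z \<in> decodable" shows "digit (decode z) = address z" "rho (decode z) = decode (expand z)"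
  using decodable_unfold(1)[OF assms] of_digits_simps[of "\<lambda>n. address ((expand ^^ n) z)"]
  by (simp_all add: decode_def funpow_swap1)

text \<open>Both sides satisfy the same recursion, in which each step divides their distance by \<open>1 - g\<close>;
  as everything stays bounded, the distance is 0.\<close>

lemma coding_decode:
  assumes "z \<in> decodable" shows "coding (decode z) = z"
proof -
  let ?e = "\<lambda>n. dist (coding (decode ((expand ^^ n) z))) ((expand ^^ n) z)"
  have "?e 0 \<le> 0"
  proof (rule contraction_zero)
    fix n
    let ?y = "(expand ^^ n) z"
    have y: "?y \<in> decodable" by (rule decodable_funpow[OF assms])
    have "coding (decode ?y) = branch (expo (address ?y)) (coding (decode (expand ?y)))"
      using coding_rec[of "decode ?y"] decode_unfold[OF y] by simp
    then have "?e n = (1 - g) * dist (coding (decode (expand ?y))) (expand ?y)"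
      using decodable_unfold(3)[OF y] dist_branch by metis
    then show "?e n \<le> (1 - g) * ?e (Suc n)" by simp
    have "?y \<in> region"
      using decodable_unfold[OF y] branch_region by metis
    then have "norm ?y \<le> 2" using region_subset_hull norm_hull by blast
    then show "?e n \<le> 4"
      using norm_hull[OF coding_hull[of "decode ?y"]] norm_triangle_ineq4[of "coding (decode ?y)" ?y]
      unfolding dist_norm by linarith
  qed (use g_bounds in auto)
  then show ?thesis by simp
qed

lemma decode_good:
  assumes "z \<in> decodable" shows "decode z \<in> good"
proof -
  have "(rho ^^ n) (decode z) = decode ((expand ^^ n) z)" for n
    by (induction n) (simp_all add: decode_unfold decodable_funpow[OF assms])
  moreover have "(expand ^^ n) z \<in> region" for n
    using decodable_unfold[OF decodable_funpow[OF assms, of n]] branch_region by metis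
  ultimately show ?thesis
    unfolding good_def using coding_decode[OF decodable_funpow[OF assms]] by simp
qed

lemma coding_decodable:
  assumes "x \<in> good" shows "coding x \<in> decodable"
proof -
  have e: "(expand ^^ n) (coding x) = coding ((rho ^^ n) x)" for n
    by (induction n) (simp_all add: address_coding(2) good_funpow_rho[OF assms])
  have "unbranch (expo (digit ((rho ^^ n) x))) ((expand ^^ n) (coding x)) \<in> region" for n
    unfolding e using good_region[OF good_funpow_rho[OF assms, of "Suc n"]] by (subst coding_rec) simp
  then show ?thesis unfolding decodable_def using digit_less by blast
qed

lemma decodable_Y': "decodable \<subseteq> Y'"
  using coding_decode coding_Y' by (metis subsetI)

lemma bij_coding: "bij_betw coding good decodable"
  by (rule bij_betw_byWitness[where f'=decode])
    (auto simp: decode_coding coding_decode decode_good coding_decodable)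

section \<open>The isomorphism\<close>

text \<open>Passing to completions needs preimages of null sets to be null, and measure-preserving maps
  provide this.\<close>

lemma completion_distr_invariant:
  assumes f: "f \<in> M \<rightarrow>\<^sub>M N" and N: "distr M N f = N"
  shows "f \<in> completion M \<rightarrow>\<^sub>M completion N" "distr (completion M) (completion N) f = completion N"
proof -
  note fc = measurable_completion[OF f]
  have d: "distr (completion M) N f = N" using N by (simp add: distr_completion[OF f])
  show "f \<in> completion M \<rightarrow>\<^sub>M completion N"
    by (rule completion.measurable_completion2[OF fc]) (simp add: d)
  show "distr (completion M) (completion N) f = completion N"
    using completion.completion_distr_eq[OF fc] by (simp add: d)
qed

lemma measurable_decode_nu: "decode \<in> nu \<rightarrow>\<^sub>M padic2_haar"
proof -
  have "decode \<in> borel_Y \<rightarrow>\<^sub>M borel" by (intro measurable_restrict_space1) simp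
  then show ?thesis by (simp cong: measurable_cong_sets)
qed

lemma measurable_coding_nu: "coding \<in> padic2_haar \<rightarrow>\<^sub>M nu"
  using measurable_coding_haar by (simp cong: measurable_cong_sets)

lemma distr_coding_nu: "distr padic2_haar nu coding = nu"
  unfolding nu_eq by (rule distr_cong) simp_all

lemma distr_decode: "distr nu padic2_haar decode = padic2_haar"
proof -
  have "distr nu padic2_haar decode = distr (distr padic2_haar nu coding) padic2_haar decode"
    by (simp add: distr_coding_nu)
  also have "\<dots> = distr padic2_haar padic2_haar (decode \<circ> coding)"
    by (rule distr_distr[OF measurable_decode_nu measurable_coding_nu])
  also have "\<dots> = distr padic2_haar padic2_haar (\<lambda>x. x)"
  proof (rule distr_cong_AE)
    show "AE x in padic2_haar. (decode \<circ> coding) x = x"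
      using AE_good by eventually_elim (simp add: decode_coding)
    show "decode \<circ> coding \<in> padic2_haar \<rightarrow>\<^sub>M padic2_haar"
      by (rule measurable_comp[OF measurable_coding_nu measurable_decode_nu])
  qed auto
  also have "\<dots> = padic2_haar" by (rule distr_id)
  finally show ?thesis .
qed

lemmas coding_completion = completion_distr_invariant[OF measurable_coding_nu distr_coding_nu]
lemmas decode_completion = completion_distr_invariant[OF measurable_decode_nu distr_decode]

lemma translate_completion:
  "(\<lambda>x. x + 1) \<in> completion padic2_haar \<rightarrow>\<^sub>M completion padic2_haar"
  "distr (completion padic2_haar) (completion padic2_haar) (\<lambda>x. x + 1) = completion padic2_haar"
proof -
  have m: "(\<lambda>x. x + 1) \<in> padic2_haar \<rightarrow>\<^sub>M padic2_haar"
    using measurable_translate[of 1] by (simp add: add.commute cong: measurable_cong_sets)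
  have "distr padic2_haar padic2_haar (\<lambda>x. x + 1) = padic2_haar"
    using haar_translate[of 1] by (metis distr_cong sets_haar)
  from completion_distr_invariant[OF m this]
  show "(\<lambda>x. x + 1) \<in> completion padic2_haar \<rightarrow>\<^sub>M completion padic2_haar"
    "distr (completion padic2_haar) (completion padic2_haar) (\<lambda>x. x + 1) = completion padic2_haar" .
qed

lemma emeasure_invariant:
  "distr M N f = N \<Longrightarrow> f \<in> M \<rightarrow>\<^sub>M N \<Longrightarrow> E \<in> sets N \<Longrightarrow> emeasure M (f -` E \<inter> space M) = emeasure N E"
  by (metis emeasure_distr)

lemma T_tilde_coding: "x \<in> good \<Longrightarrow> T_tilde (coding x) = Some (coding (x + 1))"
  using T_tilde_region[OF good_region] coding_add_one(2) by simp

lemma S_coding: "x \<in> good \<Longrightarrow> S (coding x) = Some (coding (rho x))"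
  using S_branch[OF good_region[OF good_rho[of x]] digit_less[of x]] by (simp flip: coding_rec)

lemma AE_decodable: "AE z in nu. z \<in> decodable"
proof -
  have "{z \<in> space nu. z \<in> decodable} \<in> sets nu"
    using decodable_Y' by (auto simp: sets_borel_Y Int_absorb1 Collect_conj_eq)
  then have "(AE z in distr padic2_haar nu coding. z \<in> decodable) \<longleftrightarrow> (AE x in padic2_haar. coding x \<in> decodable)"
    by (intro AE_distr_iff measurable_coding_nu) simp
  moreover have "AE x in padic2_haar. coding x \<in> decodable"
    using AE_good by eventually_elim (rule coding_decodable)
  ultimately show ?thesis unfolding distr_coding_nu by blast
qed

text \<open>On decodable points the first return map is \<open>x \<mapsto> x + 1\<close> conjugated by the coding map, so the preimage
  of \<open>E\<close> is, up to a null set, obtained by pulling \<open>E\<close> back along three measure-preserving maps.\<close>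

lemma preserves_measure_T_tilde: "preserves_measure (completion nu) T_tilde"
  unfolding preserves_measure_def
proof
  fix E assume E: "E \<in> sets (completion nu)"
  let ?Q = "{z \<in> space (completion nu). \<exists>y\<in>E. T_tilde z = Some y}"
  define F where "F = (\<lambda>x. x + 1) -` (coding -` E \<inter> space (completion padic2_haar)) \<inter> space (completion padic2_haar)"
  define Q where "Q = decode -` F \<inter> space (completion nu)"
  have cE: "coding -` E \<inter> space (completion padic2_haar) \<in> sets (completion padic2_haar)"
    using measurable_sets[OF coding_completion(1) E] .
  have F: "F \<in> sets (completion padic2_haar)"
    unfolding F_def by (rule measurable_sets[OF translate_completion(1) cE])
  have Q: "Q \<in> sets (completion nu)"
    unfolding Q_def by (rule measurable_sets[OF decode_completion(1) F])
  have "AE z in completion nu. z \<in> decodable" using AE_decodable by (simp add: AE_completion_iff)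
  then have ae: "AE z in completion nu. z \<in> Q \<longleftrightarrow> z \<in> ?Q"
  proof eventually_elim
    case (elim z)
    have "T_tilde z = Some (coding (decode z + 1))"
      using T_tilde_coding[OF decode_good[OF elim]] by (simp add: coding_decode[OF elim])
    then show ?case by (auto simp: Q_def F_def)
  qed
  have Q': "?Q \<in> sets (completion nu)"
    by (rule completion.in_sets_AE[OF ae Q]) auto
  have "emeasure (completion nu) ?Q = emeasure (completion nu) Q"
    using ae Q Q' by (intro emeasure_eq_AE) auto
  also have "\<dots> = emeasure (completion padic2_haar) F"
    unfolding Q_def by (rule emeasure_invariant[OF decode_completion(2,1) F])
  also have "\<dots> = emeasure (completion padic2_haar) (coding -` E \<inter> space (completion padic2_haar))"
    unfolding F_def by (rule emeasure_invariant[OF translate_completion(2,1) cE])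
  also have "\<dots> = emeasure (completion nu) E"
    by (rule emeasure_invariant[OF coding_completion(2,1) E])
  finally show "?Q \<in> sets (completion nu) \<and> emeasure (completion nu) ?Q = emeasure (completion nu) E"
    using Q' by blast
qed

lemma null_sets_complement_AE:
  "A \<in> sets M \<Longrightarrow> AE x in M. x \<in> A \<Longrightarrow> space M - A \<in> null_sets M"
  by (rule AE_iff_null_sets[THEN iffD2]) (auto elim: eventually_mono)

lemma good_completion:
  "good \<in> sets (completion padic2_haar)"
  "space (completion padic2_haar) - good \<in> null_sets (completion padic2_haar)"
proof -
  show g: "good \<in> sets (completion padic2_haar)" by (rule sets_completionI_sets) simp
  show "space (completion padic2_haar) - good \<in> null_sets (completion padic2_haar)"
    by (rule null_sets_complement_AE[OF g]) (simp only: AE_completion_iff AE_good)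
qed

lemma decodable_completion:
  "decodable \<in> sets (completion nu)"
  "space (completion nu) - decodable \<in> null_sets (completion nu)"
proof -
  show d: "decodable \<in> sets (completion nu)"
    by (rule sets_completionI_sets) (simp add: sets_borel_Y decodable_Y')
  show "space (completion nu) - decodable \<in> null_sets (completion nu)"
    by (rule null_sets_complement_AE[OF d]) (simp only: AE_completion_iff AE_decodable)
qed

lemma coding_isomorphism:
  "mds_isomorphism (completion padic2_haar) (\<lambda>x. Some (x + 1)) (completion nu) T_tilde coding"
  unfolding mds_isomorphism_def
proof (intro bexI[of _ good] bexI[of _ decodable] conjI ballI impI)
  let ?M = "completion padic2_haar" and ?N = "completion nu"
  show "coding \<in> restrict_space ?M good \<rightarrow>\<^sub>M restrict_space ?N decodable"
    by (intro measurable_restrict_space2 measurable_restrict_space1 coding_completion(1))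
      (auto simp: space_restrict_space coding_decodable)
  have "decode \<in> restrict_space ?N decodable \<rightarrow>\<^sub>M restrict_space ?M good"
    by (intro measurable_restrict_space2 measurable_restrict_space1 decode_completion(1))
      (auto simp: space_restrict_space decode_good)
  moreover have "inv_into good coding z = decode z" if "z \<in> decodable" for z
    by (rule inv_into_f_eq) (use that bij_coding in \<open>auto simp: bij_betw_def decode_good coding_decode\<close>)
  ultimately show "inv_into good coding \<in> restrict_space ?N decodable \<rightarrow>\<^sub>M restrict_space ?M good"
    by (subst measurable_cong[of _ _ decode]) (auto simp: space_restrict_space)
  fix E assume E: "E \<in> sets ?N" "E \<subseteq> decodable"
  have cE: "coding -` E \<inter> space ?M \<in> sets ?M" by (rule measurable_sets[OF coding_completion(1) E(1)])
  have "emeasure ?M (coding -` E \<inter> good) = emeasure ?M (coding -` E \<inter> space ?M)"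
  proof (rule emeasure_eq_AE)
    have "AE x in ?M. x \<in> good" using AE_good by (simp only: AE_completion_iff)
    then show "AE x in ?M. x \<in> coding -` E \<inter> good \<longleftrightarrow> x \<in> coding -` E \<inter> space ?M"
      by eventually_elim simp
    have "coding -` E \<inter> good = coding -` E \<inter> space ?M \<inter> good" by auto
    then show "coding -` E \<inter> good \<in> sets ?M" using cE good_completion(1) by (simp only: sets.Int)
  qed (rule cE)
  also have "\<dots> = emeasure ?N E"
    by (rule emeasure_invariant[OF coding_completion(2,1) E(1)])
  finally show "emeasure ?M (coding -` E \<inter> good) = emeasure ?N E" .
next
  fix x assume x: "x \<in> good"
  show "\<exists>y\<in>good. Some (x + 1) = Some y \<and> T_tilde (coding x) = Some (coding y)"
    using good_add_one[OF x] T_tilde_coding[OF x] by blast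
qed (use bij_coding good_completion decodable_completion in auto)

theorem theorem3:
  shows "preserves_measure (completion nu) T_tilde \<and>
    (\<exists>\<phi> :: padic2 \<Rightarrow> complex.
       mds_isomorphism (completion padic2_haar) (\<lambda>x. Some (x + 1)) (completion nu) T_tilde \<phi> \<and>
       (\<forall>x. \<phi> x \<in> Y') \<and>
       almost_inj (completion padic2_haar) \<phi> \<and>
       \<phi> \<in> completion padic2_haar \<rightarrow>\<^sub>M completion nu \<and>
       distr (completion padic2_haar) (completion nu) \<phi> = completion nu \<and>
       (AE x in completion padic2_haar. T_tilde (\<phi> x) = Some (\<phi> (x + 1))) \<and>
       (AE x in completion padic2_haar. S (\<phi> x) = Some (\<phi> (rho x))))"
proof (intro conjI exI[of _ coding] allI)
  show "almost_inj (completion padic2_haar) coding"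
    unfolding almost_inj_def
  proof (intro bexI)
    show "inj_on coding (space (completion padic2_haar) - (space (completion padic2_haar) - good))"
      using bij_coding by (auto simp: bij_betw_def double_diff)
  qed (rule good_completion)
  have ae: "AE x in completion padic2_haar. x \<in> good" using AE_good by (simp only: AE_completion_iff)
  show "AE x in completion padic2_haar. T_tilde (coding x) = Some (coding (x + 1))"
    using ae by eventually_elim (rule T_tilde_coding)
  show "AE x in completion padic2_haar. S (coding x) = Some (coding (rho x))"
    using ae by eventually_elim (rule S_coding)
qed (fact preserves_measure_T_tilde coding_isomorphism coding_Y' coding_completion)+

end
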